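(* Let $n\ge 1$, $n<p<\infty$, and let $\rho$ be an admissible measure on $\mathbb{R}^n$. Suppose $u\in\mathcal{D}^{1,p}(\mathbb{R}^n)$. Then there is $S\in\mathcal{S}(n)$ such that, for $\mu=S_\#\rho$, $$[u]_\rho=\frac{\left|\int_{\mathbb{R}^n}u(x)\,d\mu(x)\right|}{\left|\int_{\mathbb{R}^n}x\,d\mu(x)\right|^{1-n/p}}.$$
   Context: $\mathcal{D}^{1,p}(\mathbb{R}^n)$ is the space of $u\in L^1_{\rm loc}(\mathbb{R}^n)$ whose weak partial derivatives $u_{x_i}$, $i=1,\dots,n$, all belong to $L^p(\mathbb{R}^n)$. Since $p>n$, each $u$ is identified with its $(1-n/p)$-Hölder continuous representative. An admissible measure is a signed Borel measure $\rho$ on $\mathbb{R}^n$ with compact support, $\rho(\mathbb{R}^n)=0$, and $\int_{\mathbb{R}^n}y\,d\rho(y)\ne 0$. $\mathcal{S}(n)$ is the set of similarity transformations $S(y)=\lambda Oy+z$ of $\mathbb{R}^n$ with $\lambda>0$, $O\in\mathrm{O}(n)$, $z\in\mathbb{R}^n$. The push forward is $(S_\#\rho)(A)=\rho(S^{-1}(A))$ for Borel $A\subset\mathbb{R}^n$. For $u\in\mathcal{D}^{1,p}(\mathbb{R}^n)$, $$[u]_\rho:=\sup\left\{\frac{\left|\int u\,d\mu\right|}{\left|\int x\,d\mu(x)\right|^{1-n/p}}:\ \mu=S_\#\rho,\ S\in\mathcal{S}(n)\right\}.$$ *)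

theory Defs
  imports "HOL-Analysis.Analysis"
begin

section \<open>Sobolev functions\<close>

text \<open>Continuity of all iterated partial derivatives is included, since each of them is
  required to be differentiable in turn.\<close>

fun times_differentiable :: "nat \<Rightarrow> ('a::euclidean_space \<Rightarrow> real) \<Rightarrow> bool" where
  "times_differentiable 0 f \<longleftrightarrow> continuous_on UNIV f"
| "times_differentiable (Suc k) f \<longleftrightarrow>
     (\<forall>x. f differentiable (at x)) \<and>
     (\<forall>i\<in>Basis. times_differentiable k (\<lambda>x. frechet_derivative f (at x) i))"

definition test_functions :: "('a::euclidean_space \<Rightarrow> real) set" where
  "test_functions =
     {\<phi>. (\<forall>k. times_differentiable k \<phi>) \<and> compact (closure {x. \<phi> x \<noteq> 0})}"

definition locally_integrable :: "('a::euclidean_space \<Rightarrow> real) \<Rightarrow> bool" where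
  "locally_integrable f \<longleftrightarrow> (\<forall>K. compact K \<longrightarrow> set_integrable lborel K f)"

definition Lp_functions :: "real \<Rightarrow> ('a::euclidean_space \<Rightarrow> real) set" where
  "Lp_functions p =
     {f \<in> borel_measurable lborel. integrable lborel (\<lambda>x. \<bar>f x\<bar> powr p)}"

definition weak_partial_derivative ::
  "('a::euclidean_space \<Rightarrow> real) \<Rightarrow> 'a \<Rightarrow> ('a \<Rightarrow> real) \<Rightarrow> bool" where
  "weak_partial_derivative u i g \<longleftrightarrow>
     locally_integrable g \<and>
     (\<forall>\<phi>\<in>test_functions.
        (LINT x|lborel. u x * frechet_derivative \<phi> (at x) i) = - (LINT x|lborel. g x * \<phi> x))"

text \<open>Elements are functions, not classes modulo null sets; every class contains Borel
  measurable functions, so working over \<^const>\<open>lborel\<close> loses nothing.\<close>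

definition D1p :: "real \<Rightarrow> ('a::euclidean_space \<Rightarrow> real) set" where
  "D1p p = {u. locally_integrable u \<and>
               (\<forall>i\<in>Basis. \<exists>g\<in>Lp_functions p. weak_partial_derivative u i g)}"

definition holder_continuous :: "real \<Rightarrow> ('a::euclidean_space \<Rightarrow> real) \<Rightarrow> bool" where
  "holder_continuous \<alpha> u \<longleftrightarrow> (\<exists>C. \<forall>x y. \<bar>u x - u y\<bar> \<le> C * dist x y powr \<alpha>)"

section \<open>Signed measures\<close>

text \<open>A signed measure is a real-valued set function of which only the values on Borel sets
  matter. Infinite values need no provision: they cannot occur when the total mass
  is finite.\<close>

definition signed_borel_measure :: "('a::euclidean_space set \<Rightarrow> real) \<Rightarrow> bool" where
  "signed_borel_measure \<rho> \<longleftrightarrow>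
     \<rho> {} = 0 \<and>
     (\<forall>A::nat \<Rightarrow> 'a set. range A \<subseteq> sets borel \<longrightarrow> disjoint_family A \<longrightarrow>
        (\<lambda>k. \<rho> (A k)) sums \<rho> (\<Union>k. A k))"

text \<open>A point lies outside the support iff it has an open neighbourhood of total variation 0,
  that is, one all of whose Borel subsets have measure 0.\<close>

definition signed_support :: "('a::euclidean_space set \<Rightarrow> real) \<Rightarrow> 'a set" where
  "signed_support \<rho> =
     {x. \<forall>U. open U \<longrightarrow> x \<in> U \<longrightarrow> (\<exists>B\<in>sets borel. B \<subseteq> U \<and> \<rho> B \<noteq> 0)}"

text \<open>The positive part of the Jordan decomposition; the negative part of \<open>\<rho>\<close> is the positive
  part of \<open>- \<rho>\<close>.\<close>

definition positive_part :: "('a::euclidean_space set \<Rightarrow> real) \<Rightarrow> 'a measure" where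
  "positive_part \<rho> =
     measure_of UNIV (sets borel)
       (\<lambda>A. SUP B\<in>{B \<in> sets borel. B \<subseteq> A}. ennreal (\<rho> B))"

definition negative_part :: "('a::euclidean_space set \<Rightarrow> real) \<Rightarrow> 'a measure" where
  "negative_part \<rho> = positive_part (\<lambda>A. - \<rho> A)"

definition signed_integral ::
  "('a::euclidean_space set \<Rightarrow> real) \<Rightarrow> ('a \<Rightarrow> 'b::{banach, second_countable_topology}) \<Rightarrow> 'b" where
  "signed_integral \<rho> f =
     integral\<^sup>L (positive_part \<rho>) f - integral\<^sup>L (negative_part \<rho>) f"

definition admissible_measure :: "('a::euclidean_space set \<Rightarrow> real) \<Rightarrow> bool" where
  "admissible_measure \<rho> \<longleftrightarrow>
     signed_borel_measure \<rho> \<and> compact (signed_support \<rho>) \<and> \<rho> UNIV = 0 \<and>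
     signed_integral \<rho> (\<lambda>y. y) \<noteq> 0"

section \<open>Similarities and the seminorm\<close>

definition similarities :: "('a::euclidean_space \<Rightarrow> 'a) set" where
  "similarities =
     {S. \<exists>r T z. r > 0 \<and> orthogonal_transformation T \<and> S = (\<lambda>y. r *\<^sub>R T y + z)}"

definition push_forward ::
  "('a::euclidean_space \<Rightarrow> 'a) \<Rightarrow> ('a set \<Rightarrow> real) \<Rightarrow> 'a set \<Rightarrow> real" where
  "push_forward S \<rho> = (\<lambda>A. \<rho> (S -` A))"

definition difference_quotient ::
  "real \<Rightarrow> ('a::euclidean_space \<Rightarrow> real) \<Rightarrow> ('a set \<Rightarrow> real) \<Rightarrow> real" where
  "difference_quotient p u \<mu> =
     \<bar>signed_integral \<mu> u\<bar> /
     norm (signed_integral \<mu> (\<lambda>x. x)) powr (1 - real DIM('a) / p)"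

text \<open>Taken in the extended reals, so that an unbounded set of quotients has supremum \<open>\<infinity>\<close>.\<close>

definition rho_seminorm ::
  "real \<Rightarrow> ('a::euclidean_space set \<Rightarrow> real) \<Rightarrow> ('a \<Rightarrow> real) \<Rightarrow> ereal" where
  "rho_seminorm p \<rho> u =
     (SUP \<mu>\<in>{push_forward S \<rho> | S. S \<in> similarities}. ereal (difference_quotient p u \<mu>))"

end

theory Submission
  imports Defs
begin

text \<open>Morrey's inequality bounds the oscillation of \<open>u\<close> on a ball of radius \<open>r\<close>, divided by \<open>r\<close> to the
  power \<open>1 - n/p\<close>, by the \<open>L\<close>-\<open>p\<close> norm of the weak gradient on a concentric ball. Since the gradient is
  globally in \<open>L\<close>-\<open>p\<close>, this quotient tends to 0 uniformly as \<open>r\<close> tends to 0, as \<open>r\<close> tends to infinity, and as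
  the centre tends to infinity with \<open>r\<close> bounded. As \<open>\<rho>\<close> has compact support and total mass 0, the quotient
  of \<open>S\<close> is controlled by the oscillation of \<open>u\<close> on a ball whose radius is proportional to the dilation factor
  of \<open>S\<close>. Hence, unless all quotients vanish, those exceeding a fixed positive value come from a
  compact set of similarities, on which the quotient is continuous.\<close>

section \<open>Smooth bump functions\<close>

text \<open>Morrey's inequality comes from averages of \<open>u\<close> against a smooth kernel:
  when the centre and radius of the kernel move, the average changes by a flux of the weak gradient.
  Two point values are then compared by shrinking the radius at both ends and translating in
  between. The Hoelder assumption selects the representative and supplies continuity; smallness
  comes from the energy, the integral of the \<open>p\<close>-th powers of the weak derivatives.
  Large radii are the delicate regime. A large ball that meets a neighbourhood of the origin carries
  energy that need not be small, so Morrey's inequality on that ball gives only boundedness. The way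
  out is that \<open>u\<close> grows more slowly than \<open>norm x powr \<alpha>\<close>, which
  follows, up to an additive constant, from balls that stay away from the origin. The similarity
  group is noncompact only through dilations and translations, as O(n) is compact. Large
  translations need treatment only at bounded dilation, because the two extreme dilation regimes are
  uniform in the centre.\<close>

lemma times_differentiable_continuous:
  "times_differentiable k f \<Longrightarrow> continuous_on UNIV f"
  by (cases k) (auto intro: continuous_at_imp_continuous_on differentiable_imp_continuous_within)

lemma times_differentiable_SucI:
  assumes "\<And>x. (f has_derivative f' x) (at x)"
    and "\<And>i. i \<in> Basis \<Longrightarrow> times_differentiable k (\<lambda>x. f' x i)"
  shows "times_differentiable (Suc k) f"
proof -
  have "frechet_derivative f (at x) = f' x" for x
    using frechet_derivative_at[OF assms(1)[of x]] by simp
  then show ?thesis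
    using assms by (auto intro: differentiableI)
qed

lemma times_differentiable_SucD:
  "times_differentiable (Suc k) f \<Longrightarrow> times_differentiable k f"
proof (induction k arbitrary: f)
  case 0
  then show ?case
    using times_differentiable_continuous by fastforce
next
  case (Suc k)
  then show ?case
    by (metis times_differentiable.simps(2))
qed

lemma times_differentiable_has_derivative:
  "times_differentiable (Suc k) f \<Longrightarrow> (f has_derivative frechet_derivative f (at x)) (at x)"
  by (simp add: frechet_derivative_works[symmetric])

lemma times_differentiable_const: "times_differentiable k (\<lambda>x. c)"
proof (induction k arbitrary: c)
  case (Suc k)
  show ?case
    by (rule times_differentiable_SucI[where f' = "\<lambda>x h. 0"]) (auto intro: Suc)
qed auto

lemma times_differentiable_inner: "times_differentiable k (\<lambda>x. x \<bullet> b)"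
proof (cases k)
  case 0
  then show ?thesis by (simp add: continuous_intros)
next
  case (Suc j)
  show ?thesis
    unfolding Suc
    by (rule times_differentiable_SucI[where f' = "\<lambda>x h. h \<bullet> b"])
       (auto intro!: derivative_eq_intros times_differentiable_const)
qed

lemma times_differentiable_add:
  "times_differentiable k f \<Longrightarrow> times_differentiable k g \<Longrightarrow> times_differentiable k (\<lambda>x. f x + g x)"
proof (induction k arbitrary: f g)
  case 0
  then show ?case by (simp add: continuous_intros)
next
  case (Suc k)
  note D = Suc.prems[THEN times_differentiable_has_derivative]
  show ?case
    by (rule times_differentiable_SucI[OF has_derivative_add[OF D]])
       (use Suc in auto)
qed

lemma times_differentiable_mult:
  "times_differentiable k f \<Longrightarrow> times_differentiable k g \<Longrightarrow> times_differentiable k (\<lambda>x. f x * g x)"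
proof (induction k arbitrary: f g)
  case 0
  then show ?case by (simp add: continuous_intros)
next
  case (Suc k)
  note D = Suc.prems[THEN times_differentiable_has_derivative]
  show ?case
    by (rule times_differentiable_SucI[OF has_derivative_mult[OF D]])
       (intro times_differentiable_add Suc.IH Suc.prems[THEN times_differentiable_SucD],
        use Suc.prems in auto)
qed

lemma times_differentiable_sum:
  "(\<And>i. i \<in> I \<Longrightarrow> times_differentiable k (f i)) \<Longrightarrow> times_differentiable k (\<lambda>x. \<Sum>i\<in>I. f i x)"
  by (induction I rule: infinite_finite_induct)
     (auto intro: times_differentiable_add times_differentiable_const)

text \<open>\<open>flat 0\<close> is the classical smooth function vanishing to infinite order at 0.
  Dividing by powers of \<open>s\<close> gives a family whose span is closed under differentiation,
  so that smoothness becomes a single induction.\<close>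

definition flat :: "nat \<Rightarrow> real \<Rightarrow> real" where
  "flat m s = (if s > 0 then exp (- 1 / s) / s ^ m else 0)"

lemma flat_nonneg: "0 \<le> flat m s"
  by (simp add: flat_def)

lemma flat_0_le_1: "flat 0 s \<le> 1"
  by (simp add: flat_def)

text \<open>The term of order \<open>m + 2\<close> in the series of \<open>exp (1 / s)\<close> beats
  the denominator \<open>s ^ m\<close> and leaves two powers of \<open>s\<close>, enough for the
  difference quotient at 0 to tend to 0.\<close>

lemma flat_le_square: "flat m s \<le> fact (m + 2) * s\<^sup>2"
proof (cases "s > 0")
  case True
  have "(1 / s) ^ (m + 2) / fact (m + 2) \<le> exp (1 / s)"
  proof -
    have "(\<Sum>n\<in>{m+2}. inverse (fact n) *\<^sub>R (1 / s) ^ n) \<le> (\<Sum>n. inverse (fact n) *\<^sub>R (1 / s) ^ n)"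
      by (rule sum_le_suminf[OF summable_exp_generic]) (use True in auto)
    then show ?thesis
      by (simp add: exp_def field_simps del: fact_Suc)
  qed
  then have "exp (- (1 / s)) \<le> fact (m + 2) * s ^ (m + 2)"
    using True by (simp add: exp_minus field_simps del: fact_Suc power_Suc)
  also have "\<dots> = (fact (m + 2) * s\<^sup>2) * s ^ m"
    by (simp only: power_add mult_ac)
  finally have "exp (- (1 / s)) / s ^ m \<le> fact (m + 2) * s\<^sup>2"
    using True by (simp only: pos_divide_le_eq zero_less_power)
  then show ?thesis
    using True by (simp add: flat_def del: fact_Suc)
qed (simp add: flat_def)

lemma flat_has_derivative:
  "(flat m has_real_derivative flat (m + 2) s - real m * flat (m + 1) s) (at s)"
proof -
  consider "s > 0" | "s < 0" | "s = 0" by linarith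
  then show ?thesis
  proof cases
    case 1
    have "((\<lambda>s. exp (- 1 / s) / s ^ m) has_real_derivative flat (m + 2) s - real m * flat (m + 1) s) (at s)"
    proof -
      have "((\<lambda>s. exp (- 1 / s) * (1 / s) ^ m) has_real_derivative
          exp (- 1 / s) * (1 / s\<^sup>2) * (1 / s) ^ m
            + exp (- 1 / s) * (real m * (- 1 / s\<^sup>2) * (1 / s) ^ (m - 1))) (at s)"
        using 1 by (auto intro!: derivative_eq_intros simp: power2_eq_square)
      \<comment> \<open>For \<open>m = 0\<close> the exponent \<open>m - 1\<close> truncates to 0,
        harmlessly because the factor \<open>real m\<close> vanishes.\<close>
      moreover have "real m * (- 1 / s\<^sup>2) * (1 / s) ^ (m - 1) = - real m * (1 / s) ^ (m + 1)"
        by (cases m) (auto simp: power2_eq_square diff_divide_distrib add_divide_distrib algebra_simps)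
      ultimately show ?thesis
        using 1 by (cases "m = 0") (auto simp: flat_def power_divide power2_eq_square algebra_simps)
    qed
    then show ?thesis
      by (rule has_field_derivative_transform_within_open[where S = "{0<..}"])
         (use 1 in \<open>auto simp: flat_def\<close>)
  next
    case 2
    have "((\<lambda>s. 0) has_real_derivative flat (m + 2) s - real m * flat (m + 1) s) (at s)"
      using 2 by (simp add: flat_def)
    then show ?thesis
      by (rule has_field_derivative_transform_within_open[where S = "{..<0}"])
         (use 2 in \<open>auto simp: flat_def\<close>)
  next
    \<comment> \<open>Since \<open>flat m 0 = 0\<close>, the difference quotient at the origin is
      \<open>flat m h / h\<close>, which the quadratic bound controls.\<close>
    case 3
    have "\<forall>\<^sub>F h in at 0. norm (flat m h / h) \<le> fact (m + 2) * \<bar>h\<bar>"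
    proof (rule eventually_at_filter[THEN iffD2, OF always_eventually], intro allI impI)
      fix h :: real assume "h \<noteq> 0"
      then show "norm (flat m h / h) \<le> fact (m + 2) * \<bar>h\<bar>"
        using flat_le_square[of m h] flat_nonneg[of m h]
        by (simp add: divide_simps power2_eq_square mult.assoc del: fact_Suc)
    qed
    moreover have "((\<lambda>h::real. fact (m + 2) * \<bar>h\<bar>) \<longlongrightarrow> 0) (at 0)"
      by (auto intro!: tendsto_eq_intros)
    ultimately have "((\<lambda>h. flat m h / h) \<longlongrightarrow> 0) (at 0)"
      by (rule Lim_null_comparison)
    then show ?thesis
      using 3 by (simp add: DERIV_def flat_def)
  qed
qed

lemma flat_0_has_derivative: "(flat 0 has_real_derivative flat 2 s) (at s)"
  using flat_has_derivative[of 0 s] by (simp add: numeral_2_eq_2)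

lemma continuous_on_flat[continuous_intros]:
  "continuous_on S f \<Longrightarrow> continuous_on S (\<lambda>x. flat m (f x))"
  by (rule continuous_on_compose2[of UNIV "flat m"])
     (auto intro!: continuous_at_imp_continuous_on DERIV_isCont flat_has_derivative)

lemma times_differentiable_flat:
  "times_differentiable k g \<Longrightarrow> times_differentiable k (\<lambda>x. flat m (g x))"
proof (induction k arbitrary: m)
  case 0
  then show ?case by (simp add: continuous_intros)
next
  case (Suc k)
  have *: "times_differentiable k (\<lambda>x. flat (m + 2) (g x) + (- real m) * flat (m + 1) (g x))"
    by (intro times_differentiable_add times_differentiable_mult times_differentiable_const
        Suc.IH times_differentiable_SucD[OF Suc.prems])
  show ?case
    by (rule times_differentiable_SucI[OF DERIV_compose_FDERIV[OF flat_has_derivative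
            times_differentiable_has_derivative[OF Suc.prems]]])
       (use Suc.prems * in \<open>auto intro: times_differentiable_mult\<close>)
qed

section \<open>Moving averages against a bump\<close>

text \<open>For \<open>t > 0\<close> this is positive exactly on the open ball of centre
  \<open>x\<close> and radius \<open>t\<close>. The squared distance keeps it polynomial in
  \<open>y\<close>, hence smooth at the centre too.\<close>

definition bump_arg :: "'a::euclidean_space \<Rightarrow> real \<Rightarrow> 'a \<Rightarrow> real" where
  "bump_arg x t y = 1 - ((y - x) \<bullet> (y - x)) / t\<^sup>2"

text \<open>\<open>bump 0\<close> is the averaging kernel; \<open>bump 2\<close> enters because the
  derivative of \<open>flat 0\<close> is \<open>flat 2\<close>.\<close>

definition bump :: "nat \<Rightarrow> 'a::euclidean_space \<Rightarrow> real \<Rightarrow> 'a \<Rightarrow> real" where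
  "bump m x t y = flat m (bump_arg x t y)"

lemma bump_0_bounds: "0 \<le> bump 0 x t y" "bump 0 x t y \<le> 1"
  by (simp_all add: bump_def flat_nonneg flat_0_le_1)

lemma bump_eq_0:
  assumes "0 < t" "t \<le> norm (y - x)"
  shows "bump m x t y = 0"
proof -
  have "t\<^sup>2 \<le> (y - x) \<bullet> (y - x)"
    using assms by (metis dot_square_norm power_mono less_imp_le)
  then show ?thesis
    using assms by (simp add: bump_def flat_def bump_arg_def)
qed

lemma bump_outside_ball: "0 < t \<Longrightarrow> y \<notin> ball x t \<Longrightarrow> bump m x t y = 0"
  using bump_eq_0[of t y x m] by (simp add: dist_norm norm_minus_commute)

lemma continuous_on_bump: "t \<noteq> 0 \<Longrightarrow> continuous_on S (bump m x t)"
  unfolding bump_def bump_arg_def by (intro continuous_intros) auto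

text \<open>The vector \<open>v + (c / t) *\<^sub>R (y - x)\<close> is the velocity at
  \<open>y\<close> of the affine motion that carries the ball along when its centre moves with
  velocity \<open>v\<close> and its radius grows at rate \<open>c\<close>.\<close>

lemma bump_vector_has_derivative:
  fixes x v :: "'a::euclidean_space"
  assumes "t \<noteq> 0"
  shows "((\<lambda>y. bump 0 x t y * ((v + (c / t) *\<^sub>R (y - x)) \<bullet> i)) has_derivative
    (\<lambda>h. bump 2 x t y * (- 2 * ((y - x) \<bullet> h) / t\<^sup>2) * ((v + (c / t) *\<^sub>R (y - x)) \<bullet> i)
       + bump 0 x t y * (c / t * (h \<bullet> i)))) (at y)"
proof -
  have "(bump_arg x t has_derivative (\<lambda>h. - 2 * ((y - x) \<bullet> h) / t\<^sup>2)) (at y)"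
    unfolding bump_arg_def[abs_def] using assms
    by (auto intro!: derivative_eq_intros simp: inner_commute field_simps)
  from DERIV_compose_FDERIV[OF flat_0_has_derivative this]
  have "(bump 0 x t has_derivative (\<lambda>h. - 2 * ((y - x) \<bullet> h) / t\<^sup>2 * bump 2 x t y)) (at y)"
    by (simp add: bump_def[abs_def])
  moreover have "((\<lambda>y. (v + (c / t) *\<^sub>R (y - x)) \<bullet> i) has_derivative (\<lambda>h. c / t * (h \<bullet> i))) (at y)"
    by (auto intro!: derivative_eq_intros)
  ultimately show ?thesis
    by (rule has_derivative_eq_rhs[OF has_derivative_mult]) (auto simp: mult_ac)
qed

lemma bump_vector_test_function:
  fixes x v :: "'a::euclidean_space"
  assumes "0 < t"
  shows "(\<lambda>y. bump 0 x t y * ((v + (c / t) *\<^sub>R (y - x)) \<bullet> i)) \<in> test_functions"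
    (is "?\<phi> \<in> _")
proof -
  have "times_differentiable k ?\<phi>" for k
  proof -
    have shift: "(\<lambda>y. (y - x) \<bullet> b) = (\<lambda>y. y \<bullet> b + (- (x \<bullet> b)))" for b
      by (simp add: inner_diff_left)
    have td: "times_differentiable k (\<lambda>y. (y - x) \<bullet> b)" for b
      unfolding shift
      by (intro times_differentiable_add times_differentiable_const times_differentiable_inner)
    \<comment> \<open>In coordinates the squared norm is a sum of products, to which the closure
      rules for \<open>times_differentiable\<close> apply.\<close>
    have "bump_arg x t = (\<lambda>y. 1 + (- 1 / t\<^sup>2) * (\<Sum>b\<in>Basis. ((y - x) \<bullet> b) * ((y - x) \<bullet> b)))"
      by (rule ext) (simp add: bump_arg_def euclidean_inner[of "_ - x" "_ - x"])
    then have "times_differentiable k (bump_arg x t)"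
      by (simp only:) (intro times_differentiable_add times_differentiable_mult
          times_differentiable_sum times_differentiable_const td)
    moreover have "(\<lambda>y. (v + (c / t) *\<^sub>R (y - x)) \<bullet> i) = (\<lambda>y. v \<bullet> i + (c / t) * ((y - x) \<bullet> i))"
      by (simp add: inner_add_left)
    then have "times_differentiable k (\<lambda>y. (v + (c / t) *\<^sub>R (y - x)) \<bullet> i)"
      by (simp only:) (intro times_differentiable_add times_differentiable_mult
          times_differentiable_const td)
    ultimately show ?thesis
      unfolding bump_def by (intro times_differentiable_mult times_differentiable_flat)
  qed
  moreover have "{y. ?\<phi> y \<noteq> 0} \<subseteq> cball x t"
    using bump_outside_ball[OF assms] ball_subset_cball by fastforce
  then have "compact (closure {y. ?\<phi> y \<noteq> 0})"
    by (meson bounded_cball bounded_subset compact_closure)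
  ultimately show ?thesis
    by (simp add: test_functions_def)
qed

text \<open>Passes to an integral over a fixed box, the setting in which the Leibniz rule is applied
  to the moving kernel.\<close>

lemma lborel_integral_cbox:
  fixes f :: "'a::euclidean_space \<Rightarrow> real"
  assumes "continuous_on UNIV f" "\<And>y. y \<notin> cbox a b \<Longrightarrow> f y = 0"
  shows "integrable lborel f" "(LINT y|lborel. f y) = integral (cbox a b) f"
proof -
  have eq: "(\<lambda>y. indicator (cbox a b) y *\<^sub>R f y) = f"
    using assms(2) by (intro ext) (auto simp: indicator_def)
  have int: "set_integrable lborel (cbox a b) f"
    unfolding set_integrable_def
    by (rule borel_integrable_compact) (auto intro: continuous_on_subset assms)
  then show "integrable lborel f"
    by (simp only: set_integrable_def eq)
  show "(LINT y|lborel. f y) = integral (cbox a b) f"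
    using set_borel_integral_eq_integral(2)[OF int] by (simp only: set_lebesgue_integral_def eq)
qed

lemma norm_gt_of_not_in_cbox:
  fixes y :: "'a::euclidean_space"
  assumes "y \<notin> cbox (- R *\<^sub>R One) (R *\<^sub>R One)"
  shows "R < norm y"
proof -
  obtain b where "b \<in> Basis" "R < \<bar>y \<bullet> b\<bar>"
    using assms by (force simp: mem_box)
  then show ?thesis
    using Basis_le_norm[of b y] by linarith
qed

lemma continuous_compact_support_integrable:
  fixes f :: "'a::euclidean_space \<Rightarrow> real"
  assumes "continuous_on UNIV f" "\<And>y. y \<notin> ball x t \<Longrightarrow> f y = 0"
  shows "integrable lborel f"
proof (rule lborel_integral_cbox(1)[OF assms(1)])
  fix y :: 'a assume "y \<notin> cbox (- (norm x + t) *\<^sub>R One) ((norm x + t) *\<^sub>R One)"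
  then have "norm x + t < norm y" by (rule norm_gt_of_not_in_cbox)
  then show "f y = 0"
    using assms(2)[of y] norm_triangle_ineq[of "y - x" x] by (force simp: dist_norm norm_minus_commute)
qed

text \<open>The support of the kernel moves with \<open>s\<close>, so differentiation under the
  integral sign takes place on one box containing the supports for all parameters near
  \<open>s\<close>.\<close>

lemma bump_integral_has_derivative:
  fixes u :: "'a::euclidean_space \<Rightarrow> real"
  assumes u: "continuous_on UNIV u" and t0: "0 < t + s * c"
  shows "((\<lambda>s. LINT y|lborel. u y * bump 0 (x + s *\<^sub>R v) (t + s * c) y) has_real_derivative
     (LINT y|lborel. u y * (bump 2 (x + s *\<^sub>R v) (t + s * c) y *
        (2 * ((y - (x + s *\<^sub>R v)) \<bullet> (v + (c / (t + s * c)) *\<^sub>R (y - (x + s *\<^sub>R v)))) / (t + s * c)\<^sup>2)))) (at s)"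
proof -
  define X T where "X s = x + s *\<^sub>R v" and "T s = t + s * c" for s
  define G where "G s y = bump 2 (X s) (T s) y *
    (2 * ((y - X s) \<bullet> (v + (c / T s) *\<^sub>R (y - X s))) / (T s)\<^sup>2)" for s y
  \<comment> \<open>Over \<open>U\<close> the radius then changes by at most half of
    \<open>T s\<close>, so it stays positive and at most \<open>2 * T s\<close>; the added 1 allows
    for \<open>c = 0\<close>.\<close>
  define d where "d = T s / (2 * (\<bar>c\<bar> + 1))"
  define U where "U = cball s d"
  \<comment> \<open>Bounds the norm of the centre plus the radius throughout \<open>U\<close>, so
    that \<open>?B\<close> contains every ball that occurs.\<close>
  define R where "R = norm x + (\<bar>s\<bar> + d) * norm v + 2 * T s"
  let ?B = "cbox (- R *\<^sub>R One) (R *\<^sub>R One) :: 'a set"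
  have Ts: "0 < T s" using t0 by (simp add: T_def)
  have d: "0 < d" using Ts by (simp add: d_def)
  have TU: "0 < T r \<and> T r \<le> 2 * T s \<and> norm (X r) \<le> norm x + (\<bar>s\<bar> + d) * norm v" if "r \<in> U" for r
  proof -
    have r: "\<bar>r - s\<bar> \<le> d" using that by (simp add: U_def dist_real_def abs_minus_commute)
    have "d * (\<bar>c\<bar> + 1) = T s / 2" by (simp add: d_def field_simps)
    moreover have "\<bar>r - s\<bar> * \<bar>c\<bar> \<le> d * (\<bar>c\<bar> + 1)" using r by (intro mult_mono) auto
    moreover have "T r = T s + (r - s) * c" by (simp add: T_def algebra_simps)
    ultimately have "\<bar>T r - T s\<bar> \<le> T s / 2" by (simp add: abs_mult)
    moreover have "norm (X r) \<le> norm x + \<bar>r\<bar> * norm v"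
      unfolding X_def by (metis norm_scaleR norm_triangle_ineq)
    moreover have "\<bar>r\<bar> * norm v \<le> (\<bar>s\<bar> + d) * norm v"
      using r by (intro mult_right_mono) auto
    ultimately show ?thesis using Ts by linarith
  qed
  have out: "bump m (X r) (T r) y = 0" if "r \<in> U" "y \<notin> ?B" for m r y
  proof (rule bump_eq_0)
    show "T r \<le> norm (y - X r)"
      using norm_gt_of_not_in_cbox[OF that(2)] TU[OF that(1)] norm_triangle_ineq2[of y "X r"]
      unfolding R_def by linarith
  qed (use TU that in auto)
  have cont0: "continuous_on UNIV (\<lambda>y. u y * bump 0 (X r) (T r) y)" if "r \<in> U" for r
    using TU[OF that] by (intro continuous_intros u continuous_on_bump) auto
  have cont1: "continuous_on UNIV (\<lambda>y. u y * G r y)" if "r \<in> U" for r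
    using TU[OF that] unfolding G_def by (intro continuous_intros u continuous_on_bump) auto
  have nz: "t + r * c \<noteq> 0" if "r \<in> U" for r using TU[OF that] by (auto simp: T_def)
  have cont: "continuous_on (U \<times> ?B) (\<lambda>(r, y). u y * G r y)"
    unfolding G_def split_beta bump_def bump_arg_def X_def T_def using nz
    by (intro continuous_intros continuous_on_compose2[OF u]) auto
  have der: "((\<lambda>r. u y * bump 0 (X r) (T r) y) has_real_derivative u y * G r y) (at r within U)"
    if "r \<in> U" for r y
  proof -
    have "((\<lambda>r. bump_arg (X r) (T r) y) has_real_derivative
        2 * ((y - X r) \<bullet> (v + (c / T r) *\<^sub>R (y - X r))) / (T r)\<^sup>2) (at r)"
    proof -
      \<comment> \<open>The squared distance from the moving centre becomes a quadratic polynomial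
        in the parameter with constant coefficients.\<close>
      define A B C where "A = (y - x) \<bullet> (y - x)" and "B = (y - x) \<bullet> v" and "C = v \<bullet> v"
      have arg: "(\<lambda>r. bump_arg (X r) (T r) y) = (\<lambda>r. 1 - (A - 2 * r * B + r\<^sup>2 * C) / (T r)\<^sup>2)"
        by (rule ext) (simp add: bump_arg_def X_def A_def B_def C_def inner_simps inner_commute
            power2_eq_square algebra_simps)
      have alg: "0 - ((- 2 * B + 2 * r * C) * q\<^sup>2 - P * (2 * q * c)) / (q\<^sup>2 * q\<^sup>2)
          = 2 * (B - r * C + c / q * P) / q\<^sup>2" if "q \<noteq> 0" for P q
        using that by (simp add: field_simps power2_eq_square)
      have T0: "T r \<noteq> 0" using TU[OF that] by simp
      have dA: "((\<lambda>r. A - 2 * r * B + r\<^sup>2 * C) has_real_derivative - 2 * B + 2 * r * C) (at r)"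
        by (auto intro!: derivative_eq_intros)
      have dT: "((\<lambda>r. (T r)\<^sup>2) has_real_derivative 2 * T r * c) (at r)"
        unfolding T_def by (auto intro!: derivative_eq_intros)
      have der: "((\<lambda>r. 1 - (A - 2 * r * B + r\<^sup>2 * C) / (T r)\<^sup>2) has_real_derivative
          0 - ((- 2 * B + 2 * r * C) * (T r)\<^sup>2 - (A - 2 * r * B + r\<^sup>2 * C) * (2 * T r * c))
            / ((T r)\<^sup>2 * (T r)\<^sup>2)) (at r)"
        by (intro DERIV_diff DERIV_const DERIV_divide dA dT) (use T0 in auto)
      have vel: "(y - X r) \<bullet> (v + (c / T r) *\<^sub>R (y - X r)) =
          (B - r * C) + c / T r * (A - 2 * r * B + r\<^sup>2 * C)"
        by (simp add: X_def A_def B_def C_def inner_simps inner_commute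
            power2_eq_square algebra_simps)
      show ?thesis
        unfolding arg vel by (rule DERIV_cong[OF der]) (rule alg[OF T0])
    qed
    from DERIV_chain2[OF flat_0_has_derivative this]
    have "((\<lambda>r. bump 0 (X r) (T r) y) has_real_derivative G r y) (at r within U)"
      unfolding bump_def G_def
      by (rule has_field_derivative_at_within)
    then show ?thesis
      by (rule DERIV_cmult)
  qed
  have s: "s \<in> U" using d by (simp add: U_def)
  have "((\<lambda>r. integral ?B (\<lambda>y. u y * bump 0 (X r) (T r) y)) has_real_derivative
      integral ?B (\<lambda>y. u y * G s y)) (at s within U)"
  proof (rule leibniz_rule_field_derivative[OF der _ cont s])
    show "(\<lambda>y. u y * bump 0 (X r) (T r) y) integrable_on ?B" if "r \<in> U" for r
      by (intro integrable_continuous continuous_on_subset[OF cont0[OF that]]) simp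
    show "convex U"
      unfolding U_def by (rule convex_cball)
  qed assumption
  moreover have "s \<in> interior U" using d by (simp add: U_def interior_cball)
  moreover have "(LINT y|lborel. u y * G s y) = integral ?B (\<lambda>y. u y * G s y)"
    by (rule lborel_integral_cbox(2)[OF cont1[OF s]]) (unfold G_def, subst out[OF s], auto)
  ultimately have "((\<lambda>r. integral ?B (\<lambda>y. u y * bump 0 (X r) (T r) y)) has_real_derivative
      (LINT y|lborel. u y * G s y)) (at s)"
    by (simp only: at_within_interior)
  moreover have "integral ?B (\<lambda>y. u y * bump 0 (X r) (T r) y) = (LINT y|lborel. u y * bump 0 (X r) (T r) y)"
    if "dist r s < d" for r
  proof -
    have "r \<in> U" using that by (simp add: U_def dist_commute)
    then show ?thesis
      by (intro lborel_integral_cbox(2)[symmetric] cont0) (auto simp: out)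
  qed
  ultimately have "((\<lambda>r. LINT y|lborel. u y * bump 0 (X r) (T r) y) has_real_derivative
      (LINT y|lborel. u y * G s y)) (at s)"
    by (rule has_field_derivative_transform_within[OF _ d UNIV_I])
  then show ?thesis
    by (simp only: X_def T_def G_def)
qed

text \<open>The normalised kernel moves with velocity \<open>v + (c/t)(y - x)\<close>, so by the continuity equation
  its derivative in \<open>s\<close> is minus the divergence of a test field, against which \<open>u\<close> can be
  integrated by parts.\<close>

lemma bump_average_has_derivative:
  fixes u :: "'a::euclidean_space \<Rightarrow> real"
  assumes u: "continuous_on UNIV u"
    and g: "\<And>i. i \<in> Basis \<Longrightarrow> weak_partial_derivative u i (g i)"
    and t0: "0 < t + s * c"
  shows "((\<lambda>s. (LINT y|lborel. u y * bump 0 (x + s *\<^sub>R v) (t + s * c) y) / (t + s * c) ^ DIM('a))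
     has_real_derivative
     (\<Sum>i\<in>Basis. LINT y|lborel. g i y * (bump 0 (x + s *\<^sub>R v) (t + s * c) y *
        ((v + (c / (t + s * c)) *\<^sub>R (y - (x + s *\<^sub>R v))) \<bullet> i))) / (t + s * c) ^ DIM('a)) (at s)"
proof -
  define X T where "X = x + s *\<^sub>R v" and "T = t + s * c"
  define V where "V y = v + (c / T) *\<^sub>R (y - X)" for y
  have T: "0 < T" using t0 by (simp add: T_def)
  \<comment> \<open>The \<open>i\<close>-th partial derivative of the \<open>i\<close>-th component
    of the field kernel times velocity; the sum over \<open>i\<close> is its divergence.\<close>
  define D where "D i y = bump 2 X T y * (- 2 * ((y - X) \<bullet> i) / T\<^sup>2) * (V y \<bullet> i) + bump 0 X T y * (c / T)"
    for i y
  have int: "integrable lborel (\<lambda>y. u y * D i y)" for i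
    by (rule continuous_compact_support_integrable[where x = X and t = T])
       (use T in \<open>auto simp: D_def V_def bump_outside_ball
          intro!: continuous_intros u continuous_on_bump\<close>)
  have int0: "integrable lborel (\<lambda>y. u y * bump 0 X T y)"
    by (rule continuous_compact_support_integrable[where x = X and t = T])
       (use T in \<open>auto simp: bump_outside_ball intro!: continuous_intros u continuous_on_bump\<close>)
  have int2: "integrable lborel (\<lambda>y. u y * (bump 2 X T y * (2 * ((y - X) \<bullet> V y) / T\<^sup>2)))"
    by (rule continuous_compact_support_integrable[where x = X and t = T])
       (use T in \<open>auto simp: V_def bump_outside_ball intro!: continuous_intros u continuous_on_bump\<close>)
  have parts: "(LINT y|lborel. u y * D i y) = - (LINT y|lborel. g i y * (bump 0 X T y * (V y \<bullet> i)))"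
    if i: "i \<in> Basis" for i
  proof -
    let ?\<phi> = "\<lambda>y. bump 0 X T y * (V y \<bullet> i)"
    have "frechet_derivative ?\<phi> (at y) i = D i y" for y
      using frechet_derivative_at[OF bump_vector_has_derivative[of T X v c i y], symmetric] T i
      by (simp add: V_def D_def)
    moreover have "?\<phi> \<in> test_functions"
      using bump_vector_test_function[OF T] by (simp add: V_def)
    ultimately show ?thesis
      using bspec[OF conjunct2[OF g[OF i, unfolded weak_partial_derivative_def]], of ?\<phi>]
      by (simp only:)
  qed
  \<comment> \<open>The first term is minus the derivative of the kernel in \<open>s\<close>. The
    second comes from the expansion of the ball and is cancelled by the derivative of the
    normalising power \<open>(t + s * c) ^ DIM('a)\<close>.\<close>
  have divergence: "(\<Sum>i\<in>Basis. D i y) =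
      - (bump 2 X T y * (2 * ((y - X) \<bullet> V y) / T\<^sup>2)) + real DIM('a) * c / T * bump 0 X T y" for y
    by (simp add: D_def sum.distrib euclidean_inner[of "y - X" "V y"] sum_distrib_left
        sum_divide_distrib sum_negf sum_subtractf mult_ac)
  have "(\<Sum>i\<in>Basis. LINT y|lborel. g i y * (bump 0 X T y * (V y \<bullet> i))) =
      - (\<Sum>i\<in>Basis. LINT y|lborel. u y * D i y)"
    by (simp add: parts sum_negf)
  also have "(\<Sum>i\<in>Basis. LINT y|lborel. u y * D i y) = (LINT y|lborel. (\<Sum>i\<in>Basis. u y * D i y))"
    by (rule Bochner_Integration.integral_sum[symmetric]) (rule int)
  also have "\<dots> = (LINT y|lborel. - (u y * (bump 2 X T y * (2 * ((y - X) \<bullet> V y) / T\<^sup>2)))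
      + real DIM('a) * c / T * (u y * bump 0 X T y))"
    by (simp only: sum_distrib_left[symmetric] divergence) (simp add: algebra_simps)
  also have "\<dots> = - (LINT y|lborel. u y * (bump 2 X T y * (2 * ((y - X) \<bullet> V y) / T\<^sup>2)))
      + real DIM('a) * c / T * (LINT y|lborel. u y * bump 0 X T y)"
  proof -
    have "(LINT y|lborel. - (u y * (bump 2 X T y * (2 * ((y - X) \<bullet> V y) / T\<^sup>2)))
        + real DIM('a) * c / T * (u y * bump 0 X T y)) =
      (LINT y|lborel. - (u y * (bump 2 X T y * (2 * ((y - X) \<bullet> V y) / T\<^sup>2))))
        + (LINT y|lborel. real DIM('a) * c / T * (u y * bump 0 X T y))"
      by (intro Bochner_Integration.integral_add Bochner_Integration.integrable_minus
          integrable_mult_right int2 int0)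
    then show ?thesis
      by (simp only: Bochner_Integration.integral_minus integral_mult_right_zero)
  qed
  finally have eq: "(\<Sum>i\<in>Basis. LINT y|lborel. g i y * (bump 0 X T y * (V y \<bullet> i))) =
      (LINT y|lborel. u y * (bump 2 X T y * (2 * ((y - X) \<bullet> V y) / T\<^sup>2)))
      - real DIM('a) * c / T * (LINT y|lborel. u y * bump 0 X T y)"
    by simp
  have "((\<lambda>s. (t + s * c) ^ DIM('a)) has_real_derivative real DIM('a) * c * T ^ (DIM('a) - 1)) (at s)"
    unfolding T_def by (auto intro!: derivative_eq_intros)
  then have "((\<lambda>s. (t + s * c) ^ DIM('a)) has_real_derivative real DIM('a) * c / T * T ^ DIM('a)) (at s)"
    by (rule DERIV_cong) (use T in \<open>simp add: power_minus_mult[of "DIM('a)" T, OF DIM_positive, symmetric]\<close>)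
  note quotient = DERIV_divide[OF bump_integral_has_derivative[OF u t0, of x v] this]
  have alg: "(N' * q - N * (k * q)) / (q * q) = (N' - k * N) / q" if "q \<noteq> 0" for N N' k q :: real
    using that by (simp add: field_simps)
  show ?thesis
    using T unfolding X_def[symmetric] T_def[symmetric] V_def[symmetric] eq
    by (intro DERIV_cong[OF quotient[folded X_def T_def, folded V_def]] alg) auto
qed

section \<open>Morrey's inequality and uniform decay of oscillation\<close>

lemma lborel_integral_affine:
  fixes f :: "'a::euclidean_space \<Rightarrow> real"
  assumes "c \<noteq> 0" "f \<in> borel_measurable borel"
  shows "(LINT y|lborel. f y) = \<bar>c\<bar> ^ DIM('a) * (LINT w|lborel. f (x + c *\<^sub>R w))"
proof -
  have "(LINT y|lborel. f y) =
      (LINT y|density (distr lborel borel (\<lambda>w. x + c *\<^sub>R w)) (\<lambda>_. \<bar>c\<bar> ^ DIM('a)). f y)"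
    by (subst lborel_affine[OF assms(1), of x]) simp
  also have "\<dots> = (LINT y|distr lborel borel (\<lambda>w. x + c *\<^sub>R w). \<bar>c\<bar> ^ DIM('a) * f y)"
    using assms(2) by (subst integral_density) (auto simp: ennreal_power[symmetric])
  also have "\<dots> = (LINT w|lborel. \<bar>c\<bar> ^ DIM('a) * f (x + c *\<^sub>R w))"
    using assms(2) by (subst integral_distr) auto
  finally show ?thesis by simp
qed

text \<open>Where \<open>b\<close> exceeds the threshold \<open>a\<close>, the factor
  \<open>(b / a) powr (p - 1)\<close> is at least 1. With \<open>b\<close> a gradient component, the
  part below the threshold contributes volume and the part above it contributes energy.\<close>

lemma le_add_powr:
  fixes a b p :: real
  assumes "0 < a" "0 \<le> b" "1 < p"
  shows "b \<le> a + a powr (1 - p) * b powr p"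
proof (cases "b \<le> a")
  case False
  then have "b = b powr (1 - p) * b powr p"
    using assms by (simp add: powr_add[symmetric])
  also have "\<dots> \<le> a powr (1 - p) * b powr p"
    using assms False by (intro mult_right_mono powr_mono2') auto
  finally show ?thesis using assms by simp
qed (use assms in \<open>simp add: add_increasing2\<close>)

text \<open>The averages are normalised by \<open>t ^ DIM('a)\<close> alone, so their limit at
  \<open>x\<close> is this multiple of \<open>u x\<close>. The type argument carries the
  dimension.\<close>

definition bump_mass :: "'a::euclidean_space itself \<Rightarrow> real" where
  "bump_mass _ = (LINT y|lborel. bump 0 (0::'a) 1 y)"

lemma integrable_bump: "0 < t \<Longrightarrow> integrable lborel (bump 0 x t)"
  by (rule continuous_compact_support_integrable[where x = x and t = t])
     (auto intro: continuous_on_bump bump_outside_ball)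

text \<open>On the ball of radius 1/2 the argument of \<open>flat\<close> is at least 1/2, so the
  kernel is at least \<open>exp (-2)\<close> there.\<close>

lemma bump_mass_pos: "0 < bump_mass TYPE('a::euclidean_space)"
proof -
  let ?B = "ball (0::'a) (1/2)"
  have le: "exp (-2) * indicator ?B y \<le> bump 0 0 1 y" for y :: 'a
  proof (cases "y \<in> ?B")
    case True
    then have "norm y * norm y \<le> 1/2 * (1/2)"
      by (intro mult_mono) auto
    then have "y \<bullet> y \<le> 1/4"
      by (simp add: dot_square_norm power2_eq_square)
    then have "1 / 2 \<le> bump_arg 0 1 y" by (simp add: bump_arg_def)
    then have "exp (-2) \<le> bump 0 0 1 y"
      by (simp add: bump_def flat_def divide_simps)
    then show ?thesis using True by simp
  qed (simp add: bump_0_bounds)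
  have "0 < exp (-2) * measure lborel ?B"
    by (simp add: content_ball_pos)
  also have "\<dots> = (LINT y|lborel. exp (-2) * indicator ?B y)"
    by simp
  also have "\<dots> \<le> bump_mass TYPE('a)"
    unfolding bump_mass_def
    by (intro integral_mono integrable_bump integrable_mult_right integrable_real_indicator le
        emeasure_lborel_ball_finite) auto
  finally show ?thesis .
qed

locale holder_sobolev =
  fixes u :: "'a::euclidean_space \<Rightarrow> real" and g :: "'a \<Rightarrow> 'a \<Rightarrow> real" and p :: real
  assumes dim_less: "real DIM('a) < p"
    and holder: "holder_continuous (1 - real DIM('a) / p) u"
    and weak: "\<And>i. i \<in> Basis \<Longrightarrow> weak_partial_derivative u i (g i)"
    and Lp: "\<And>i. i \<in> Basis \<Longrightarrow> g i \<in> Lp_functions p"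
begin

definition \<alpha> :: real where "\<alpha> = 1 - real DIM('a) / p"

text \<open>Comparable to the \<open>p\<close>-th power of the Euclidean norm of the weak gradient,
  but additive over components.\<close>

definition gradient_density :: "'a \<Rightarrow> real" where "gradient_density y = (\<Sum>i\<in>Basis. \<bar>g i y\<bar> powr p)"

definition energy :: "'a set \<Rightarrow> real" where
  "energy A = (LINT y|lborel. indicator A y * gradient_density y)"

lemma p_gt_1: "1 < p"
  using dim_less DIM_ge_Suc0[where 'a='a] by linarith

lemma \<alpha>_pos: "0 < \<alpha>"
  using dim_less p_gt_1 by (auto simp: \<alpha>_def field_simps)

lemma holder_const: obtains C where "0 < C" "\<And>x y. \<bar>u x - u y\<bar> \<le> C * dist x y powr \<alpha>"
proof -
  obtain C where C: "\<And>x y. \<bar>u x - u y\<bar> \<le> C * dist x y powr \<alpha>"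
    using holder unfolding holder_continuous_def \<alpha>_def by blast
  show ?thesis
  proof
    show "\<bar>u x - u y\<bar> \<le> (\<bar>C\<bar> + 1) * dist x y powr \<alpha>" for x y
      by (rule order_trans[OF C]) (auto intro: mult_right_mono)
  qed auto
qed

lemma continuous_u: "continuous_on UNIV u"
proof -
  obtain C where C: "0 < C" "\<And>x y. \<bar>u x - u y\<bar> \<le> C * dist x y powr \<alpha>"
    using holder_const by metis
  have "(u \<longlongrightarrow> u x) (at x)" for x
  proof (rule LIM_zero_cancel, rule Lim_null_comparison)
    show "\<forall>\<^sub>F y in at x. norm (u y - u x) \<le> C * dist y x powr \<alpha>"
      using C by simp
    have "((\<lambda>y. C * dist y x powr \<alpha>) \<longlongrightarrow> C * dist x x powr \<alpha>) (at x)"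
      using \<alpha>_pos by (intro tendsto_intros tendsto_powr') auto
    then show "((\<lambda>y. C * dist y x powr \<alpha>) \<longlongrightarrow> 0) (at x)" by simp
  qed
  then show ?thesis
    by (simp add: continuous_on_def tendsto_within_subset)
qed

lemma integrable_gradient_density_comp: "i \<in> Basis \<Longrightarrow> integrable lborel (\<lambda>y. \<bar>g i y\<bar> powr p)"
  using Lp by (simp add: Lp_functions_def)

lemma integrable_gradient_density: "integrable lborel gradient_density"
  unfolding gradient_density_def by (intro Bochner_Integration.integrable_sum integrable_gradient_density_comp)

lemma gradient_density_nonneg: "0 \<le> gradient_density y"
  by (simp add: gradient_density_def sum_nonneg)

lemma integrable_indicator_gradient_density:
  "A \<in> sets borel \<Longrightarrow> integrable lborel (\<lambda>y. indicator A y * gradient_density y)"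
  using integrable_mult_indicator[of A lborel gradient_density] integrable_gradient_density by simp

lemma energy_nonneg: "0 \<le> energy A"
  unfolding energy_def by (intro integral_nonneg_AE) (simp add: gradient_density_nonneg)

lemma energy_mono:
  assumes "A \<subseteq> B" "B \<in> sets borel"
  shows "energy A \<le> energy B"
  unfolding energy_def
  by (rule integral_mono'[OF integrable_indicator_gradient_density[OF assms(2)]])
     (use assms in \<open>auto simp: indicator_def gradient_density_nonneg\<close>)

text \<open>The constant left by \<open>le_add_powr\<close> on a ball once the powers of the radius
  are taken out: the volume term counted once per component, plus the energy. It is small if
  \<epsilon> is small and the energy is small depending on \<epsilon>.\<close>

definition rate :: "real \<Rightarrow> 'a set \<Rightarrow> real" where
  "rate \<epsilon> B = real DIM('a) * unit_ball_vol (real DIM('a)) * \<epsilon> + \<epsilon> powr (1 - p) * energy B"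

lemma rate_mono: "A \<subseteq> B \<Longrightarrow> B \<in> sets borel \<Longrightarrow> rate \<epsilon> A \<le> rate \<epsilon> B"
  by (simp add: rate_def energy_mono mult_left_mono)

lemma rate_nonneg: "0 < \<epsilon> \<Longrightarrow> 0 \<le> rate \<epsilon> A"
  by (simp add: rate_def energy_nonneg)

text \<open>On the ball the kernel is at most 1 and every coordinate of the velocity at most
  \<open>norm v + \<bar>c\<bar>\<close>, which leaves the gradient to be integrated.\<close>

lemma bump_flux_le:
  fixes x v :: 'a
  assumes T: "0 < T" and \<epsilon>: "0 < \<epsilon>"
  shows "\<bar>(\<Sum>i\<in>Basis. LINT y|lborel. g i y * (bump 0 x T y * ((v + (c / T) *\<^sub>R (y - x)) \<bullet> i)))
    / T ^ DIM('a)\<bar> \<le> (norm v + \<bar>c\<bar>) * T powr (\<alpha> - 1) * rate \<epsilon> (ball x T)"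
proof -
  \<comment> \<open>This power of \<open>T\<close> balances the two terms: since
    \<open>\<alpha> - 1 = - real DIM('a) / p\<close>, volume and energy both scale like
    \<open>T powr (\<alpha> - 1)\<close> after division by \<open>T ^ DIM('a)\<close>.\<close>
  define a where "a = \<epsilon> * T powr (\<alpha> - 1)"
  let ?B = "ball x T"
  let ?f = "\<lambda>i y. g i y * (bump 0 x T y * ((v + (c / T) *\<^sub>R (y - x)) \<bullet> i))"
  have a: "0 < a" using T \<epsilon> by (simp add: a_def)
  have vel: "\<bar>(v + (c / T) *\<^sub>R (y - x)) \<bullet> i\<bar> \<le> norm v + \<bar>c\<bar>" if "y \<in> ?B" "i \<in> Basis" for y i
  proof -
    have "\<bar>(v + (c / T) *\<^sub>R (y - x)) \<bullet> i\<bar> \<le> norm (v + (c / T) *\<^sub>R (y - x))"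
      by (rule Basis_le_norm[OF that(2)])
    also have "\<dots> \<le> norm v + \<bar>c\<bar> / T * norm (y - x)"
      using T norm_triangle_ineq[of v "(c / T) *\<^sub>R (y - x)"] by simp
    also have "\<bar>c\<bar> / T * norm (y - x) \<le> \<bar>c\<bar> / T * T"
      using that T by (intro mult_left_mono) (auto simp: dist_norm norm_minus_commute)
    finally show ?thesis using T by simp
  qed
  have pointwise: "\<bar>?f i y\<bar> \<le>
      (norm v + \<bar>c\<bar>) * (a * indicator ?B y + a powr (1 - p) * (indicator ?B y * \<bar>g i y\<bar> powr p))"
    if i: "i \<in> Basis" for i y
  proof (cases "y \<in> ?B")
    case True
    have "\<bar>?f i y\<bar> = \<bar>g i y\<bar> * (bump 0 x T y * \<bar>(v + (c / T) *\<^sub>R (y - x)) \<bullet> i\<bar>)"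
      by (simp add: abs_mult bump_0_bounds)
    also have "\<dots> \<le> (a + a powr (1 - p) * \<bar>g i y\<bar> powr p) * (1 * (norm v + \<bar>c\<bar>))"
      using a p_gt_1 by (intro mult_mono le_add_powr vel True i bump_0_bounds) (auto simp: bump_0_bounds)
    finally show ?thesis using True by (simp add: mult_ac)
  qed (simp add: bump_outside_ball[OF T])
  have int: "integrable lborel (\<lambda>y. indicator ?B y * \<bar>g i y\<bar> powr p)" if "i \<in> Basis" for i
    using integrable_mult_indicator[OF _ integrable_gradient_density_comp[OF that], of ?B] by simp
  have intB: "integrable lborel (indicator ?B :: 'a \<Rightarrow> real)"
    by (intro integrable_real_indicator emeasure_lborel_ball_finite) simp
  have comp: "\<bar>LINT y|lborel. ?f i y\<bar> \<le> (norm v + \<bar>c\<bar>) *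
      (a * measure lborel ?B + a powr (1 - p) * (LINT y|lborel. indicator ?B y * \<bar>g i y\<bar> powr p))"
    if i: "i \<in> Basis" for i
  proof -
    have "\<bar>LINT y|lborel. ?f i y\<bar> \<le> (LINT y|lborel. \<bar>?f i y\<bar>)"
      by (rule integral_abs_bound)
    also have "\<dots> \<le> (LINT y|lborel. (norm v + \<bar>c\<bar>) *
        (a * indicator ?B y + a powr (1 - p) * (indicator ?B y * \<bar>g i y\<bar> powr p)))"
      using a by (intro integral_mono' pointwise i integrable_mult_right
          Bochner_Integration.integrable_add intB int) auto
    also have "\<dots> = (norm v + \<bar>c\<bar>) *
        (a * measure lborel ?B + a powr (1 - p) * (LINT y|lborel. indicator ?B y * \<bar>g i y\<bar> powr p))"
      by (simp add: Bochner_Integration.integral_add intB int[OF i])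
    finally show ?thesis .
  qed
  have "\<bar>\<Sum>i\<in>Basis. LINT y|lborel. ?f i y\<bar> \<le> (\<Sum>i\<in>Basis. (norm v + \<bar>c\<bar>) *
      (a * measure lborel ?B + a powr (1 - p) * (LINT y|lborel. indicator ?B y * \<bar>g i y\<bar> powr p)))"
    by (rule order_trans[OF sum_abs]) (intro sum_mono comp)
  also have "\<dots> = (norm v + \<bar>c\<bar>) * (real DIM('a) * (a * measure lborel ?B) + a powr (1 - p) *
      (\<Sum>i\<in>Basis. LINT y|lborel. indicator ?B y * \<bar>g i y\<bar> powr p))"
    by (simp only: sum_distrib_left[symmetric] sum.distrib) simp
  also have "(\<Sum>i\<in>Basis. LINT y|lborel. indicator ?B y * \<bar>g i y\<bar> powr p) = energy ?B"
    unfolding energy_def gradient_density_def sum_distrib_left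
    by (rule Bochner_Integration.integral_sum[symmetric]) (rule int)
  finally have le: "\<bar>\<Sum>i\<in>Basis. LINT y|lborel. ?f i y\<bar> / T ^ DIM('a) \<le> (norm v + \<bar>c\<bar>) *
      (real DIM('a) * (a * measure lborel ?B) + a powr (1 - p) * energy ?B) / T ^ DIM('a)"
    using T by (intro divide_right_mono) auto
  have m: "measure lborel ?B = unit_ball_vol (real DIM('a)) * T ^ DIM('a)"
    using T by (simp add: content_ball)
  have "a powr (1 - p) / T ^ DIM('a) = \<epsilon> powr (1 - p) * T powr (\<alpha> - 1)"
  proof -
    have e: "(\<alpha> - 1) * (1 - p) - real DIM('a) = \<alpha> - 1"
      using p_gt_1 by (simp add: \<alpha>_def field_simps)
    have "a powr (1 - p) / T ^ DIM('a) = \<epsilon> powr (1 - p) * (T powr ((\<alpha> - 1) * (1 - p)) / T powr real DIM('a))"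
      using T \<epsilon> by (simp add: a_def powr_mult powr_powr powr_realpow)
    also have "\<dots> = \<epsilon> powr (1 - p) * T powr (\<alpha> - 1)"
      by (simp only: powr_diff[symmetric] e)
    finally show ?thesis .
  qed
  then have "a powr (1 - p) * energy ?B / T ^ DIM('a) = T powr (\<alpha> - 1) * (\<epsilon> powr (1 - p) * energy ?B)"
    by (metis mult.assoc mult.commute times_divide_eq_left)
  moreover have "real DIM('a) * (a * measure lborel ?B) / T ^ DIM('a)
      = T powr (\<alpha> - 1) * (real DIM('a) * unit_ball_vol (real DIM('a)) * \<epsilon>)"
    using T by (simp add: m a_def)
  ultimately have "(norm v + \<bar>c\<bar>) *
      (real DIM('a) * (a * measure lborel ?B) + a powr (1 - p) * energy ?B) / T ^ DIM('a)
      = (norm v + \<bar>c\<bar>) * T powr (\<alpha> - 1) * rate \<epsilon> ?B"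
    by (simp only: rate_def times_divide_eq_right[symmetric] add_divide_distrib distrib_left mult.assoc)
  with le show ?thesis
    using T by simp
qed

section \<open>Comparing averages at different centres and radii\<close>

definition average :: "'a \<Rightarrow> real \<Rightarrow> real" where
  "average x t = (LINT y|lborel. u y * bump 0 x t y) / t ^ DIM('a)"

text \<open>Mean value theorem along the segment from \<open>x\<close> to \<open>x + v\<close> at
  fixed radius; all balls met on the way lie in the enlarged ball, whose rate dominates.\<close>

lemma average_translate:
  assumes t: "0 < t" and \<epsilon>: "0 < \<epsilon>"
  shows "\<bar>average (x + v) t - average x t\<bar> \<le> norm v * t powr (\<alpha> - 1) * rate \<epsilon> (ball x (t + norm v))"
proof -
  define D where "D s = (\<Sum>i\<in>Basis. LINT y|lborel. g i y * (bump 0 (x + s *\<^sub>R v) t y *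
      ((v + (0 / t) *\<^sub>R (y - (x + s *\<^sub>R v))) \<bullet> i))) / t ^ DIM('a)" for s
  have "((\<lambda>s. average (x + s *\<^sub>R v) t) has_real_derivative D s) (at s)" for s
    using bump_average_has_derivative[OF continuous_u weak, of t s 0 x v] t
    by (simp add: average_def D_def)
  then obtain s where s: "0 < s" "s < 1"
    "average (x + 1 *\<^sub>R v) t - average (x + 0 *\<^sub>R v) t = (1 - 0) * D s"
    using MVT2[of 0 1 "\<lambda>s. average (x + s *\<^sub>R v) t" D] by auto
  have "\<bar>D s\<bar> \<le> (norm v + \<bar>0\<bar>) * t powr (\<alpha> - 1) * rate \<epsilon> (ball (x + s *\<^sub>R v) t)"
    unfolding D_def by (rule bump_flux_le[OF t \<epsilon>])
  also have "\<dots> \<le> (norm v + \<bar>0\<bar>) * t powr (\<alpha> - 1) * rate \<epsilon> (ball x (t + norm v))"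
  proof (intro mult_left_mono rate_mono)
    have "norm (s *\<^sub>R v) \<le> norm v" using s by (simp add: mult_left_le_one_le)
    moreover have "dist x y \<le> norm (s *\<^sub>R v) + dist (x + s *\<^sub>R v) y" for y
      by (metis add_diff_cancel_left' dist_commute dist_norm dist_triangle)
    ultimately show "ball (x + s *\<^sub>R v) t \<subseteq> ball x (t + norm v)"
      by (smt (verit, best) mem_ball subsetI)
  qed auto
  finally show ?thesis using s by simp
qed

text \<open>The speed bound \<open>r powr (\<alpha> - 1)\<close> has the primitive
  \<open>r powr \<alpha> / \<alpha>\<close>, which stays bounded as \<open>r\<close> tends to 0
  because \<open>p\<close> exceeds the dimension.\<close>

lemma average_scale:
  assumes s: "0 < s" "s \<le> t" and \<epsilon>: "0 < \<epsilon>"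
  shows "\<bar>average x t - average x s\<bar> \<le> rate \<epsilon> (ball x t) / \<alpha> * (t powr \<alpha> - s powr \<alpha>)"
proof -
  define D where "D r = (\<Sum>i\<in>Basis. LINT y|lborel. g i y * (bump 0 x r y *
      ((0 + (1 / r) *\<^sub>R (y - x)) \<bullet> i))) / r ^ DIM('a)" for r
  define K where "K = rate \<epsilon> (ball x t)"
  have der: "(average x has_real_derivative D r) (at r)" if "0 < r" for r
    using bump_average_has_derivative[OF continuous_u weak, of 0 r 1 x 0] that
    unfolding average_def[abs_def] D_def by simp
  have D: "\<bar>D r\<bar> \<le> K * r powr (\<alpha> - 1)" if "0 < r" "r \<le> t" for r
  proof -
    have "\<bar>D r\<bar> \<le> (norm (0::'a) + \<bar>1\<bar>) * r powr (\<alpha> - 1) * rate \<epsilon> (ball x r)"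
      unfolding D_def by (rule bump_flux_le[OF that(1) \<epsilon>])
    also have "\<dots> \<le> (norm (0::'a) + \<bar>1\<bar>) * r powr (\<alpha> - 1) * K"
      using that unfolding K_def by (intro mult_left_mono rate_mono) auto
    finally show ?thesis by (simp add: mult.commute)
  qed
  have pow: "((\<lambda>r. K / \<alpha> * r powr \<alpha>) has_real_derivative K * r powr (\<alpha> - 1)) (at r)" if "0 < r" for r
    using that \<alpha>_pos by (auto intro!: derivative_eq_intros)
  \<comment> \<open>Instead of integrating the derivative, the average is compared with the
    primitive of its bound: their difference is nonincreasing and their sum nondecreasing.\<close>
  have "average x t - K / \<alpha> * t powr \<alpha> \<le> average x s - K / \<alpha> * s powr \<alpha>"
  proof (rule DERIV_nonpos_imp_nonincreasing[OF s(2)], intro exI conjI)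
    fix r assume r: "s \<le> r" "r \<le> t"
    show "((\<lambda>r. average x r - K / \<alpha> * r powr \<alpha>) has_real_derivative D r - K * r powr (\<alpha> - 1)) (at r)"
      using r s by (intro DERIV_diff der pow) auto
    show "D r - K * r powr (\<alpha> - 1) \<le> 0" using D[of r] r s by auto
  qed
  moreover have "average x s + K / \<alpha> * s powr \<alpha> \<le> average x t + K / \<alpha> * t powr \<alpha>"
  proof (rule DERIV_nonneg_imp_nondecreasing[OF s(2)], intro exI conjI)
    fix r assume r: "s \<le> r" "r \<le> t"
    show "((\<lambda>r. average x r + K / \<alpha> * r powr \<alpha>) has_real_derivative D r + K * r powr (\<alpha> - 1)) (at r)"
      using r s by (intro DERIV_add der pow) auto
    show "0 \<le> D r + K * r powr (\<alpha> - 1)" using D[of r] r s by auto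
  qed
  ultimately have "\<bar>average x t - average x s\<bar> \<le> K / \<alpha> * t powr \<alpha> - K / \<alpha> * s powr \<alpha>"
    by linarith
  then show ?thesis by (simp only: K_def right_diff_distrib)
qed

text \<open>The substitution \<open>y = x + t *\<^sub>R w\<close> freezes the kernel, and Hoelder
  continuity bounds the error by a multiple of \<open>t powr \<alpha>\<close>. The limit is thus
  identified at every point, not just almost everywhere.\<close>

lemma average_tendsto: "(average x \<longlongrightarrow> bump_mass TYPE('a) * u x) (at_right 0)"
proof -
  obtain C where C: "0 < C" "\<And>x y. \<bar>u x - u y\<bar> \<le> C * dist x y powr \<alpha>"
    using holder_const by metis
  have "\<bar>average x t - bump_mass TYPE('a) * u x\<bar> \<le> C * bump_mass TYPE('a) * t powr \<alpha>" if t: "0 < t" for t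
  proof -
    let ?b = "bump 0 (0::'a) 1"
    have arg: "bump 0 x t (x + t *\<^sub>R w) = ?b w" for w
      using t by (simp add: bump_def bump_arg_def power2_eq_square)
    have cu: "continuous_on UNIV (\<lambda>w. u (x + t *\<^sub>R w))"
      by (intro continuous_on_compose2[OF continuous_u] continuous_intros) auto
    have int: "integrable lborel (\<lambda>w. u (x + t *\<^sub>R w) * ?b w)"
      by (rule continuous_compact_support_integrable[where x = 0 and t = 1])
         (auto intro!: continuous_intros cu continuous_on_bump simp: bump_outside_ball)
    have "average x t = (LINT w|lborel. u (x + t *\<^sub>R w) * ?b w)"
    proof -
      have "(\<lambda>y. u y * bump 0 x t y) \<in> borel_measurable borel"
        using t by (intro borel_measurable_continuous_onI continuous_intros continuous_u continuous_on_bump) auto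
      from lborel_integral_affine[OF _ this, of t x] t show ?thesis
        by (simp add: average_def arg)
    qed
    then have "average x t - bump_mass TYPE('a) * u x =
        (LINT w|lborel. u (x + t *\<^sub>R w) * ?b w) - (LINT w|lborel. u x * ?b w)"
      by (simp add: bump_mass_def)
    also have "\<dots> = (LINT w|lborel. (u (x + t *\<^sub>R w) - u x) * ?b w)"
      unfolding left_diff_distrib
      by (intro Bochner_Integration.integral_diff[symmetric] int integrable_mult_right integrable_bump) simp
    finally have "\<bar>average x t - bump_mass TYPE('a) * u x\<bar> =
        \<bar>LINT w|lborel. (u (x + t *\<^sub>R w) - u x) * ?b w\<bar>" by simp
    also have "\<dots> \<le> (LINT w|lborel. \<bar>(u (x + t *\<^sub>R w) - u x) * ?b w\<bar>)"
      by (rule integral_abs_bound)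
    also have "\<dots> \<le> (LINT w|lborel. C * t powr \<alpha> * ?b w)"
    proof (rule integral_mono')
      fix w :: 'a
      show "\<bar>(u (x + t *\<^sub>R w) - u x) * ?b w\<bar> \<le> C * t powr \<alpha> * ?b w"
      proof (cases "w \<in> ball 0 1")
        case True
        have "dist (x + t *\<^sub>R w) x powr \<alpha> \<le> t powr \<alpha>"
          using True t \<alpha>_pos by (intro powr_mono2) (auto simp: dist_norm)
        then have "\<bar>u (x + t *\<^sub>R w) - u x\<bar> \<le> C * t powr \<alpha>"
          using C by (meson mult_left_mono less_imp_le order_trans)
        then show ?thesis
          by (simp add: abs_mult bump_0_bounds mult_right_mono)
      qed (simp add: bump_outside_ball)
    qed (use C in \<open>auto simp: bump_0_bounds integrable_bump\<close>)
    also have "\<dots> = C * bump_mass TYPE('a) * t powr \<alpha>"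
      by (simp add: bump_mass_def)
    finally show ?thesis .
  qed
  then have "\<forall>\<^sub>F t in at_right 0. norm (average x t - bump_mass TYPE('a) * u x)
      \<le> C * bump_mass TYPE('a) * t powr \<alpha>"
    by (auto simp: eventually_at_filter)
  moreover have "((\<lambda>t. C * bump_mass TYPE('a) * t powr \<alpha>) \<longlongrightarrow> 0) (at_right 0)"
  proof -
    have "((\<lambda>t. C * bump_mass TYPE('a) * t powr \<alpha>) \<longlongrightarrow> C * bump_mass TYPE('a) * 0 powr \<alpha>) (at_right 0)"
      using \<alpha>_pos by (intro tendsto_intros tendsto_powr') (auto simp: eventually_at_filter)
    then show ?thesis by simp
  qed
  ultimately have "((\<lambda>t. average x t - bump_mass TYPE('a) * u x) \<longlongrightarrow> 0) (at_right 0)"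
    by (rule Lim_null_comparison)
  then show ?thesis
    by (rule LIM_zero_cancel)
qed

text \<open>The limit of \<open>average_scale\<close> as the inner radius tends to 0.\<close>

lemma average_near:
  assumes t: "0 < t" and \<epsilon>: "0 < \<epsilon>"
  shows "\<bar>average x t - bump_mass TYPE('a) * u x\<bar> \<le> rate \<epsilon> (ball x t) / \<alpha> * t powr \<alpha>"
proof (rule tendsto_upperbound)
  show "((\<lambda>s. \<bar>average x t - average x s\<bar>) \<longlongrightarrow> \<bar>average x t - bump_mass TYPE('a) * u x\<bar>) (at_right 0)"
    by (intro tendsto_intros average_tendsto)
  have "\<bar>average x t - average x s\<bar> \<le> rate \<epsilon> (ball x t) / \<alpha> * t powr \<alpha>" if "0 < s" "s < t" for s
  proof -
    have "rate \<epsilon> (ball x t) / \<alpha> * (t powr \<alpha> - s powr \<alpha>) \<le> rate \<epsilon> (ball x t) / \<alpha> * t powr \<alpha>"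
      using \<alpha>_pos rate_nonneg[OF \<epsilon>] by (intro mult_left_mono) auto
    then show ?thesis
      using average_scale[of s t \<epsilon> x] that \<epsilon> by linarith
  qed
  then show "\<forall>\<^sub>F s in at_right 0. \<bar>average x t - average x s\<bar> \<le> rate \<epsilon> (ball x t) / \<alpha> * t powr \<alpha>"
    using t by (auto simp: eventually_at_right[of 0 t])
qed auto

text \<open>A form of Morrey's inequality that suffices for compactness and avoids the Hoelder
  inequality: it is used with \<open>\<epsilon>\<close> fixed and \<open>energy (ball x (3 * r))\<close> tending to 0.\<close>

lemma morrey_rate:
  assumes r: "0 < r" "dist x y \<le> r" and \<epsilon>: "0 < \<epsilon>"
  shows "bump_mass TYPE('a) * \<bar>u x - u y\<bar> \<le> (2 / \<alpha> + 1) * rate \<epsilon> (ball x (3 * r)) * r powr \<alpha>"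
proof -
  let ?K = "rate \<epsilon> (ball x (3 * r))"
  \<comment> \<open>The balls of radius \<open>r\<close> about \<open>x\<close> and
    \<open>y\<close>, and those swept in the translation, all lie in \<open>ball x (3 * r)\<close>,
    so one rate serves for all three comparisons.\<close>
  have near: "\<bar>average z r - bump_mass TYPE('a) * u z\<bar> \<le> ?K / \<alpha> * r powr \<alpha>" if "dist x z \<le> r" for z
  proof -
    have "dist x w \<le> dist x z + dist z w" for w by (rule dist_triangle)
    then have "ball z r \<subseteq> ball x (3 * r)" using that r by (smt (verit, best) mem_ball subsetI)
    then have "rate \<epsilon> (ball z r) / \<alpha> * r powr \<alpha> \<le> ?K / \<alpha> * r powr \<alpha>"
      using \<alpha>_pos by (intro mult_right_mono divide_right_mono rate_mono) auto
    then show ?thesis using average_near[OF r(1) \<epsilon>, of z] by linarith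
  qed
  have "\<bar>average y r - average x r\<bar> \<le> norm (y - x) * r powr (\<alpha> - 1) * rate \<epsilon> (ball x (r + norm (y - x)))"
    using average_translate[OF r(1) \<epsilon>, of x "y - x"] by simp
  also have "\<dots> \<le> r * r powr (\<alpha> - 1) * ?K"
    using r rate_nonneg[OF \<epsilon>]
    by (intro mult_mono rate_mono subset_ball) (auto simp: dist_norm norm_minus_commute)
  also have "r * r powr (\<alpha> - 1) = r powr \<alpha>"
    using r powr_mult_base[of r "\<alpha> - 1"] by simp
  finally have "\<bar>average y r - average x r\<bar> \<le> r powr \<alpha> * ?K" .
  with near[of x] near[of y] r have
    "\<bar>bump_mass TYPE('a) * u x - bump_mass TYPE('a) * u y\<bar> \<le> 2 * (?K / \<alpha> * r powr \<alpha>) + r powr \<alpha> * ?K"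
    by simp
  moreover have "bump_mass TYPE('a) * \<bar>u x - u y\<bar> = \<bar>bump_mass TYPE('a) * u x - bump_mass TYPE('a) * u y\<bar>"
    using bump_mass_pos[where 'a='a] by (simp add: right_diff_distrib[symmetric] abs_mult)
  moreover have "2 * (?K / \<alpha> * r powr \<alpha>) + r powr \<alpha> * ?K = (2 / \<alpha> + 1) * ?K * r powr \<alpha>"
    by (simp add: distrib_right distrib_left add_divide_distrib mult_ac)
  ultimately show ?thesis
    by linarith
qed

text \<open>The gain is uniformity: \<delta> depends on \<epsilon> but on neither the centre nor the
  radius, since \<open>rate\<close> involves the ball through its energy alone.\<close>

lemma morrey:
  assumes \<epsilon>: "0 < \<epsilon>"
  obtains \<delta> where "0 < \<delta>"
    "\<And>x y r. 0 < r \<Longrightarrow> dist x y \<le> r \<Longrightarrow> energy (ball x (3 * r)) \<le> \<delta> \<Longrightarrow> \<bar>u x - u y\<bar> \<le> \<epsilon> * r powr \<alpha>"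
proof -
  define \<kappa> where "\<kappa> = bump_mass TYPE('a)"
  define A where "A = 2 / \<alpha> + 1"
  define N where "N = real DIM('a) * unit_ball_vol (real DIM('a))"
  \<comment> \<open>The budget for the rate is \<open>\<kappa> * \<epsilon> / A\<close>. The choice
    of \<open>e\<close> gives half of it to the volume term; \<delta> gives the other half to the
    energy, whose weight \<open>e powr (1 - p)\<close> is fixed by then.\<close>
  define e where "e = \<kappa> * \<epsilon> / (2 * A * N)"
  define \<delta> where "\<delta> = \<kappa> * \<epsilon> / (2 * A * e powr (1 - p))"
  have pos: "0 < \<kappa>" "0 < A" "0 < N"
    using \<alpha>_pos bump_mass_pos by (auto simp: \<kappa>_def A_def N_def add_pos_pos)
  then have e: "0 < e" using \<epsilon> by (simp add: e_def)
  show thesis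
  proof
    show "0 < \<delta>" using pos e \<epsilon> by (simp add: \<delta>_def)
    fix x y r assume r: "0 < r" "dist x y \<le> r" and en: "energy (ball x (3 * r)) \<le> \<delta>"
    have "rate e (ball x (3 * r)) \<le> N * e + e powr (1 - p) * \<delta>"
      unfolding rate_def N_def using en by (intro add_left_mono mult_left_mono) auto
    also have "\<dots> = \<kappa> * \<epsilon> / A"
      using pos e by (simp add: \<delta>_def, simp add: e_def field_simps)
    finally have "A * rate e (ball x (3 * r)) \<le> \<kappa> * \<epsilon>"
      using pos by (simp add: field_simps)
    then have "A * rate e (ball x (3 * r)) * r powr \<alpha> \<le> \<kappa> * \<epsilon> * r powr \<alpha>"
      by (intro mult_right_mono) auto
    with morrey_rate[OF r e] have "\<kappa> * \<bar>u x - u y\<bar> \<le> \<kappa> * (\<epsilon> * r powr \<alpha>)"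
      unfolding A_def \<kappa>_def by (simp add: mult.assoc)
    then show "\<bar>u x - u y\<bar> \<le> \<epsilon> * r powr \<alpha>" using pos by simp
  qed
qed

section \<open>Energy of small balls and of complements of large balls\<close>

lemma energy_small_balls:
  assumes "0 < \<delta>"
  obtains a where "0 < a" "\<And>x r. 0 < r \<Longrightarrow> r < a \<Longrightarrow> energy (ball x (3 * r)) \<le> \<delta>"
proof -
  have meas: "gradient_density \<in> borel_measurable borel"
    using integrable_gradient_density by (simp add: borel_measurable_integrable)
  \<comment> \<open>Absolute continuity of the integral by truncation: the part of the density above
    level \<open>k\<close> has small integral for large \<open>k\<close>, and the rest is bounded,
    so its integral is controlled by the volume.\<close>
  define f where "f k y = (if real k < gradient_density y then gradient_density y else 0)" for k y
  have fm: "f k \<in> borel_measurable lborel" for k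
    unfolding f_def using meas by measurable
  have "(\<lambda>k. LINT y|lborel. f k y) \<longlonglongrightarrow> (LINT y::'a|lborel. 0)"
  proof (rule integral_dominated_convergence[where w = gradient_density])
    show "AE y in lborel. (\<lambda>k. f k y) \<longlonglongrightarrow> 0"
    proof (rule AE_I2)
      fix y
      obtain m where "gradient_density y < real m" using reals_Archimedean2 by blast
      then have "\<forall>k\<ge>m. f k y = 0" by (auto simp: f_def)
      then show "(\<lambda>k. f k y) \<longlonglongrightarrow> 0"
        using eventually_sequentially by (intro tendsto_eventually) blast
    qed
  qed (use fm integrable_gradient_density in \<open>auto simp: f_def gradient_density_nonneg\<close>)
  then have "(\<lambda>k. LINT y|lborel. f k y) \<longlonglongrightarrow> 0" by simp
  then have "\<forall>\<^sub>F k in sequentially. (LINT y|lborel. f k y) < \<delta> / 2"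
    using assms by (intro order_tendstoD(2)) auto
  then obtain k where k: "(LINT y|lborel. f k y) < \<delta> / 2"
    by (meson eventually_sequentially order_refl)
  have intf: "integrable lborel (f k)"
    by (rule Bochner_Integration.integrable_bound[OF integrable_gradient_density fm]) (auto simp: f_def gradient_density_nonneg)
  define N where "N = (real k + 1) * unit_ball_vol (real DIM('a))"
  have N: "0 < N" by (simp add: N_def)
  \<comment> \<open>The bound 1/3 gives \<open>3 * r < 1\<close>, so the volume is at most linear in
    \<open>r\<close>; the other bound keeps its contribution within
    \<open>\<delta> / 2\<close>.\<close>
  define a where "a = min (1/3) (\<delta> / (6 * N))"
  show thesis
  proof
    show "0 < a" using N assms by (simp add: a_def)
    fix x :: 'a and r :: real assume r: "0 < r" "r < a"
    let ?B = "ball x (3 * r)"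
    have intB: "integrable lborel (indicator ?B :: 'a \<Rightarrow> real)"
      by (intro integrable_real_indicator emeasure_lborel_ball_finite) simp
    have "energy ?B \<le> (LINT y|lborel. f k y + (real k + 1) * indicator ?B y)"
      unfolding energy_def
    proof (rule integral_mono')
      show "indicator ?B y * gradient_density y \<le> f k y + (real k + 1) * indicator ?B y" for y
        by (auto simp: f_def indicator_def gradient_density_nonneg)
      show "0 \<le> f k y + (real k + 1) * indicator ?B y" for y
        by (auto simp: f_def gradient_density_nonneg)
    qed (intro Bochner_Integration.integrable_add integrable_mult_right intf intB)
    also have "\<dots> = (LINT y|lborel. f k y) + (real k + 1) * measure lborel ?B"
      by (subst Bochner_Integration.integral_add)
         (auto intro!: intf integrable_real_indicator emeasure_lborel_ball_finite)
    also have "(real k + 1) * measure lborel ?B = N * (3 * r) ^ DIM('a)"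
      using r by (simp add: content_ball N_def)
    also have "N * (3 * r) ^ DIM('a) \<le> N * (3 * r)"
    proof -
      have "(3 * r) ^ DIM('a) \<le> (3 * r) ^ 1"
        using r by (intro power_decreasing) (auto simp: a_def DIM_ge_Suc0)
      then show ?thesis using N by simp
    qed
    also have "N * (3 * r) \<le> \<delta> / 2"
    proof -
      have "r \<le> \<delta> / (6 * N)" using r by (simp add: a_def)
      then show ?thesis using N by (simp add: field_simps)
    qed
    finally show "energy ?B \<le> \<delta>" using k by simp
  qed
qed

lemma energy_tail:
  assumes "0 < \<delta>"
  obtains R where "0 < R" "energy (- ball 0 R) \<le> \<delta>"
proof -
  have meas: "gradient_density \<in> borel_measurable borel"
    using integrable_gradient_density by (simp add: borel_measurable_integrable)
  have "(\<lambda>k. LINT y|lborel. indicator (- ball 0 (real k)) y * gradient_density y) \<longlonglongrightarrow> (LINT y::'a|lborel. 0)"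
  proof (rule integral_dominated_convergence[where w = gradient_density])
    show "AE y in lborel. (\<lambda>k. indicator (- ball 0 (real k)) y * gradient_density y) \<longlonglongrightarrow> 0"
    proof (rule AE_I2)
      fix y :: 'a
      obtain m where "norm y < real m" using reals_Archimedean2 by blast
      then have "\<forall>k\<ge>m. indicator (- ball 0 (real k)) y * gradient_density y = 0"
        by (auto simp: indicator_def)
      then show "(\<lambda>k. indicator (- ball 0 (real k)) y * gradient_density y) \<longlonglongrightarrow> 0"
        using eventually_sequentially by (intro tendsto_eventually) blast
    qed
    show "(\<lambda>y. indicator (- ball 0 (real k)) y * gradient_density y) \<in> borel_measurable lborel" for k
      using meas by measurable
  qed (use integrable_gradient_density in \<open>auto simp: indicator_def gradient_density_nonneg\<close>)
  then have "\<forall>\<^sub>F k in sequentially. energy (- ball 0 (real k)) < \<delta>"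
    using assms unfolding energy_def by (intro order_tendstoD(2)) auto
  then obtain k where "\<forall>j\<ge>k. energy (- ball 0 (real j)) < \<delta>"
    by (auto simp: eventually_sequentially)
  \<comment> \<open>The successor makes the radius positive even if \<open>k\<close> is 0.\<close>
  then have "energy (- ball 0 (real (Suc k))) \<le> \<delta>"
    by (meson le_SucI less_imp_le order_refl)
  then show thesis
    by (intro that[of "real (Suc k)"]) auto
qed

section \<open>Oscillation in the three noncompact regimes\<close>

lemma decay_small_scale:
  assumes "0 < \<epsilon>"
  obtains a where "0 < a"
    "\<And>x y r. 0 < r \<Longrightarrow> r < a \<Longrightarrow> dist x y \<le> r \<Longrightarrow> \<bar>u x - u y\<bar> \<le> \<epsilon> * r powr \<alpha>"
  using morrey[OF assms] energy_small_balls by metis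

lemma decay_far:
  assumes "0 < \<epsilon>" "0 < b"
  obtains Z where
    "\<And>x y r. 0 < r \<Longrightarrow> r \<le> b \<Longrightarrow> dist x y \<le> r \<Longrightarrow> Z \<le> norm x \<Longrightarrow> \<bar>u x - u y\<bar> \<le> \<epsilon> * r powr \<alpha>"
proof -
  obtain \<delta> where \<delta>: "0 < \<delta>"
    "\<And>x y r. 0 < r \<Longrightarrow> dist x y \<le> r \<Longrightarrow> energy (ball x (3 * r)) \<le> \<delta> \<Longrightarrow> \<bar>u x - u y\<bar> \<le> \<epsilon> * r powr \<alpha>"
    using morrey[OF assms(1)] by metis
  obtain R where R: "0 < R" "energy (- ball 0 R) \<le> \<delta>"
    using energy_tail[OF \<delta>(1)] by metis
  show thesis
  proof
    \<comment> \<open>The witness is \<open>R + 3 * b\<close>: from there on, balls of radius up to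
      \<open>3 * b\<close> miss \<open>ball 0 R\<close>.\<close>
    fix x y :: 'a and r :: real assume r: "0 < r" "r \<le> b" "dist x y \<le> r" "R + 3 * b \<le> norm x"
    have "ball x (3 * r) \<subseteq> - ball 0 R"
    proof
      fix z assume "z \<in> ball x (3 * r)"
      then have "dist x z < 3 * b" using r by simp
      then show "z \<in> - ball 0 R"
        using norm_triangle_ineq2[of x z] r by (simp add: dist_norm)
    qed
    then have "energy (ball x (3 * r)) \<le> \<delta>"
      using R(2) energy_mono by (meson borel_comp open_ball borel_open order_trans)
    then show "\<bar>u x - u y\<bar> \<le> \<epsilon> * r powr \<alpha>"
      by (rule \<delta>(2)[OF r(1,3)])
  qed
qed

text \<open>Walking from \<open>x\<close> towards the origin in steps \<open>x, (5/6) x, (5/6)\<^sup>2 x, \<dots>\<close> keeps the balls of Morrey's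
  inequality away from the origin, so that only the tail of the energy enters.\<close>

lemma sublinear_growth:
  assumes "0 < \<epsilon>"
  obtains K where "0 < K" "\<And>x. \<bar>u x - u 0\<bar> \<le> \<epsilon> * norm x powr \<alpha> + K"
proof -
  \<comment> \<open>One step multiplies \<open>norm x powr \<alpha>\<close> by \<open>q\<close>.
    Granting it the share \<open>\<epsilon> * (1 - q)\<close> makes the geometric series sum to
    \<epsilon>.\<close>
  define q where "q = (5/6) powr \<alpha>"
  have q: "0 < q" "q < 1"
    using \<alpha>_pos powr_less_mono2[of \<alpha> "5/6" 1] by (auto simp: q_def)
  have e: "0 < \<epsilon> * (1 - q)" using assms q by simp
  obtain \<delta> where \<delta>: "0 < \<delta>" "\<And>x y r. 0 < r \<Longrightarrow> dist x y \<le> r \<Longrightarrow> energy (ball x (3 * r)) \<le> \<delta>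
      \<Longrightarrow> \<bar>u x - u y\<bar> \<le> \<epsilon> * (1 - q) * r powr \<alpha>"
    using morrey[OF e] by metis
  obtain R where R: "0 < R" "energy (- ball 0 R) \<le> \<delta>"
    using energy_tail[OF \<delta>(1)] by metis
  obtain C where C: "0 < C" "\<And>x y. \<bar>u x - u y\<bar> \<le> C * dist x y powr \<alpha>"
    using holder_const by metis
  define K where "K = C * (2 * R) powr \<alpha>"
  have near: "\<bar>u x - u 0\<bar> \<le> \<epsilon> * norm x powr \<alpha> + K" if "norm x \<le> 2 * R" for x
  proof -
    have "\<bar>u x - u 0\<bar> \<le> C * norm x powr \<alpha>" using C(2)[of x 0] by simp
    also have "\<dots> \<le> K"
      unfolding K_def using C that \<alpha>_pos by (intro mult_left_mono powr_mono2) auto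
    finally show ?thesis using assms by (simp add: add_increasing)
  qed
  have step: "\<bar>u x - u ((5/6) *\<^sub>R x)\<bar> \<le> \<epsilon> * (1 - q) * norm x powr \<alpha>" if "2 * R < norm x" for x
  proof -
    \<comment> \<open>The step has length \<open>norm x / 6\<close>, so Morrey's ball has radius
      \<open>norm x / 2\<close> and misses \<open>ball 0 R\<close> as long as \<open>norm x\<close>
      exceeds \<open>2 * R\<close>. This is the origin of the ratio 5/6.\<close>
    let ?r = "norm x / 6"
    have r: "0 < ?r" using that R by linarith
    have "x - (5/6) *\<^sub>R x = (1/6) *\<^sub>R x" by (simp add: diff_eq_eq flip: scaleR_add_left)
    then have d: "dist x ((5/6) *\<^sub>R x) \<le> ?r" by (simp add: dist_norm)
    have "ball x (3 * ?r) \<subseteq> - ball 0 R"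
    proof
      fix z assume "z \<in> ball x (3 * ?r)"
      then show "z \<in> - ball 0 R"
        using norm_triangle_ineq2[of x z] that by (simp add: dist_norm)
    qed
    then have "energy (ball x (3 * ?r)) \<le> \<delta>"
      using R(2) energy_mono by (meson borel_comp open_ball borel_open order_trans)
    from \<delta>(2)[OF r d this] have "\<bar>u x - u ((5/6) *\<^sub>R x)\<bar> \<le> \<epsilon> * (1 - q) * ?r powr \<alpha>" .
    also have "\<dots> \<le> \<epsilon> * (1 - q) * norm x powr \<alpha>"
      using e \<alpha>_pos by (intro mult_left_mono powr_mono2) auto
    finally show ?thesis .
  qed
  \<comment> \<open>Induction on the number of steps needed to reach \<open>cball 0 (2 * R)\<close>;
    the constant \<open>K\<close> is paid once, at the end of the walk.\<close>
  have all: "\<bar>u x - u 0\<bar> \<le> \<epsilon> * norm x powr \<alpha> + K" if "norm x \<le> 2 * R * (6/5) ^ n" for n x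
    using that
  proof (induction n arbitrary: x)
    case 0
    then show ?case using near by simp
  next
    case (Suc n)
    show ?case
    proof (cases "norm x \<le> 2 * R")
      case False
      have "norm ((5/6) *\<^sub>R x) \<le> 2 * R * (6/5) ^ n"
        using Suc.prems by simp
      from Suc.IH[OF this] have "\<bar>u ((5/6) *\<^sub>R x) - u 0\<bar> \<le> \<epsilon> * (q * norm x powr \<alpha>) + K"
        unfolding norm_scaleR by (subst (asm) powr_mult) (auto simp: q_def)
      moreover have "\<epsilon> * (1 - q) * norm x powr \<alpha> + \<epsilon> * (q * norm x powr \<alpha>) = \<epsilon> * norm x powr \<alpha>"
        by (simp add: algebra_simps)
      ultimately show ?thesis using step[of x] False by linarith
    qed (rule near)
  qed
  show thesis
  proof
    show "0 < K" using C R by (simp add: K_def)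
    fix x :: 'a
    obtain n where "norm x / (2 * R) < (6/5) ^ n"
      using real_arch_pow[of "6/5"] by auto
    then have "norm x \<le> 2 * R * (6/5) ^ n" using R by (simp add: field_simps)
    then show "\<bar>u x - u 0\<bar> \<le> \<epsilon> * norm x powr \<alpha> + K" by (rule all)
  qed
qed

text \<open>If \<open>x\<close> is far from the origin relative to \<open>r\<close>, Morrey's ball
  sees just the tail of the energy. Otherwise \<open>x\<close> and \<open>y\<close> both have norm
  at most \<open>5 * r\<close>, and both values are compared with \<open>u 0\<close> by sublinear
  growth.\<close>

lemma decay_large_scale:
  assumes "0 < \<epsilon>"
  obtains b where "0 < b"
    "\<And>x y r. b \<le> r \<Longrightarrow> dist x y \<le> r \<Longrightarrow> \<bar>u x - u y\<bar> \<le> \<epsilon> * r powr \<alpha>"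
proof -
  \<comment> \<open>On \<open>cball 0 (5 * r)\<close> the growth term is then at most
    \<open>\<epsilon> / 4 * r powr \<alpha>\<close>, so the two endpoints use half of the
    bound.\<close>
  define e where "e = \<epsilon> / (4 * 5 powr \<alpha>)"
  have e: "0 < e" using assms by (simp add: e_def)
  obtain \<delta> where \<delta>: "0 < \<delta>"
    "\<And>x y r. 0 < r \<Longrightarrow> dist x y \<le> r \<Longrightarrow> energy (ball x (3 * r)) \<le> \<delta> \<Longrightarrow> \<bar>u x - u y\<bar> \<le> \<epsilon> * r powr \<alpha>"
    using morrey[OF assms] by metis
  obtain R where R: "0 < R" "energy (- ball 0 R) \<le> \<delta>"
    using energy_tail[OF \<delta>(1)] by metis
  obtain K where K: "0 < K" "\<And>x. \<bar>u x - u 0\<bar> \<le> e * norm x powr \<alpha> + K"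
    using sublinear_growth[OF e] by metis
  \<comment> \<open>The second entry makes the two additive constants \<open>K\<close> together fit
    into the other half of the bound; the first makes \<open>ball 0 r\<close> contain
    \<open>ball 0 R\<close>.\<close>
  define b where "b = max R ((4 * K / \<epsilon>) powr (1 / \<alpha>))"
  show thesis
  proof
    show b: "0 < b" using R by (simp add: b_def)
    fix x y :: 'a and r :: real assume r: "b \<le> r" "dist x y \<le> r"
    have r0: "0 < r" using b r by simp
    show "\<bar>u x - u y\<bar> \<le> \<epsilon> * r powr \<alpha>"
    proof (cases "4 * r \<le> norm x")
      case True
      have "ball x (3 * r) \<subseteq> - ball 0 R"
      proof
        fix z assume "z \<in> ball x (3 * r)"
        then show "z \<in> - ball 0 R"
          using norm_triangle_ineq2[of x z] True r by (simp add: dist_norm b_def)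
      qed
      then have "energy (ball x (3 * r)) \<le> \<delta>"
        using R(2) energy_mono by (meson borel_comp open_ball borel_open order_trans)
      then show ?thesis by (rule \<delta>(2)[OF r0 r(2)])
    next
      case False
      have "4 * K / \<epsilon> = ((4 * K / \<epsilon>) powr (1 / \<alpha>)) powr \<alpha>"
        using \<alpha>_pos K assms by (simp add: powr_powr)
      also have "\<dots> \<le> r powr \<alpha>"
        using r \<alpha>_pos by (intro powr_mono2) (auto simp: b_def)
      finally have K_le: "2 * K \<le> \<epsilon> / 2 * r powr \<alpha>" using assms by (simp add: field_simps)
      have bound: "\<bar>u z - u 0\<bar> \<le> \<epsilon> / 4 * r powr \<alpha> + K" if "norm z \<le> 5 * r" for z
      proof -
        have "e * norm z powr \<alpha> \<le> e * (5 * r) powr \<alpha>"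
          using e that \<alpha>_pos by (intro mult_left_mono powr_mono2) auto
        also have "\<dots> = \<epsilon> / 4 * r powr \<alpha>"
          using r0 by (simp add: e_def powr_mult)
        finally show ?thesis using K(2)[of z] by linarith
      qed
      have "norm y \<le> norm x + dist x y"
        by (metis dist_commute dist_norm norm_triangle_sub)
      then have "norm x \<le> 5 * r" "norm y \<le> 5 * r" using False r r0 by auto
      then show ?thesis using bound[of x] bound[of y] K_le by linarith
    qed
  qed
qed

end

section \<open>Jordan decomposition of a signed measure\<close>

locale signed_measure =
  fixes \<rho> :: "'a::euclidean_space set \<Rightarrow> real"
  assumes signed: "signed_borel_measure \<rho>"
begin

text \<open>The set function inside \<open>positive_part\<close>, studied on its own because
  \<open>measure_of\<close> reproduces it only once countable additivity is known.\<close>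

definition positive_mass :: "'a set \<Rightarrow> ennreal" where
  "positive_mass A = (SUP B\<in>{B \<in> sets borel. B \<subseteq> A}. ennreal (\<rho> B))"

lemma empty: "\<rho> {} = 0"
  using signed by (simp add: signed_borel_measure_def)

lemma sums:
  "(\<And>k. A k \<in> sets borel) \<Longrightarrow> disjoint_family A \<Longrightarrow> (\<lambda>k::nat. \<rho> (A k)) sums \<rho> (\<Union>k. A k)"
  using signed unfolding signed_borel_measure_def by blast

lemma union:
  assumes "A \<in> sets borel" "B \<in> sets borel" "A \<inter> B = {}"
  shows "\<rho> (A \<union> B) = \<rho> A + \<rho> B"
proof -
  have "(\<lambda>k. \<rho> (binaryset A B k)) sums \<rho> (\<Union>k. binaryset A B k)"
    using assms by (intro sums) (auto simp: binaryset_def disjoint_family_on_def)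
  moreover have "(\<lambda>k. \<rho> (binaryset A B k)) sums (\<rho> A + \<rho> B)"
    by (rule binaryset_sums) (rule empty)
  ultimately show ?thesis
    by (simp add: UN_binaryset_eq sums_unique2)
qed

lemma diff:
  assumes "A \<in> sets borel" "B \<in> sets borel" "A \<subseteq> B"
  shows "\<rho> (B - A) = \<rho> B - \<rho> A"
proof -
  have "\<rho> (A \<union> (B - A)) = \<rho> A + \<rho> (B - A)"
    using assms by (intro union) auto
  moreover have "A \<union> (B - A) = B" using assms by auto
  ultimately show ?thesis by simp
qed

lemma positive_mass_upper: "B \<in> sets borel \<Longrightarrow> B \<subseteq> A \<Longrightarrow> ennreal (\<rho> B) \<le> positive_mass A"
  unfolding positive_mass_def by (intro SUP_upper) auto

lemma positive_mass_least:
  "(\<And>B. B \<in> sets borel \<Longrightarrow> B \<subseteq> A \<Longrightarrow> ennreal (\<rho> B) \<le> c) \<Longrightarrow> positive_mass A \<le> c"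
  unfolding positive_mass_def by (intro SUP_least) auto

lemma positive_mass_empty: "positive_mass {} = 0"
  using positive_mass_least[of "{}" 0] empty by simp

lemma positive_mass_mono: "A \<subseteq> B \<Longrightarrow> positive_mass A \<le> positive_mass B"
  by (rule positive_mass_least) (auto intro: positive_mass_upper)

lemma positive_mass_superadd:
  assumes "A \<inter> B = {}"
  shows "positive_mass A + positive_mass B \<le> positive_mass (A \<union> B)"
proof -
  have ne: "{C \<in> sets borel. C \<subseteq> X} \<noteq> {}" for X :: "'a set"
    by (auto intro: exI[of _ "{}"])
  have pair: "ennreal (\<rho> C) + ennreal (\<rho> D) \<le> positive_mass (A \<union> B)"
    if CD: "C \<in> sets borel" "C \<subseteq> A" "D \<in> sets borel" "D \<subseteq> B" for C D
  proof -
    \<comment> \<open>\<open>ennreal\<close> cuts negative values off at 0, so additivity of \<rho>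
      transfers when both values are nonnegative; otherwise one of the two sets suffices as
      competitor.\<close>
    consider "\<rho> C \<le> 0" | "\<rho> D \<le> 0" | "0 \<le> \<rho> C" "0 \<le> \<rho> D" by linarith
    then show ?thesis
    proof cases
      case 1
      then show ?thesis
        using positive_mass_upper[of D "A \<union> B"] CD by (auto simp: ennreal_neg)
    next
      case 2
      then show ?thesis
        using positive_mass_upper[of C "A \<union> B"] CD by (auto simp: ennreal_neg)
    next
      case 3
      moreover have "\<rho> (C \<union> D) = \<rho> C + \<rho> D" using CD assms by (intro union) auto
      ultimately have "ennreal (\<rho> C) + ennreal (\<rho> D) = ennreal (\<rho> (C \<union> D))" by simp
      then show ?thesis using positive_mass_upper[of "C \<union> D" "A \<union> B"] CD by auto
    qed
  qed
  have "(SUP D\<in>{D \<in> sets borel. D \<subseteq> B}. ennreal (\<rho> D) + ennreal (\<rho> C)) \<le> positive_mass (A \<union> B)"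
    if "C \<in> sets borel" "C \<subseteq> A" for C
    using that pair by (intro SUP_least) (simp add: add.commute[of "ennreal (\<rho> _)" "ennreal (\<rho> C)"])
  then have "ennreal (\<rho> C) + positive_mass B \<le> positive_mass (A \<union> B)"
    if "C \<in> sets borel" "C \<subseteq> A" for C
    using that unfolding ennreal_SUP_add_left[OF ne] positive_mass_def[of B, symmetric]
    by (simp add: add.commute)
  then have "(SUP C\<in>{C \<in> sets borel. C \<subseteq> A}. ennreal (\<rho> C) + positive_mass B) \<le> positive_mass (A \<union> B)"
    by (intro SUP_least) auto
  then show ?thesis
    unfolding ennreal_SUP_add_left[OF ne] positive_mass_def[of A, symmetric] .
qed

text \<open>One inequality is superadditivity on finite unions. For the other, a competitor in the
  union is sliced along the family, and each slice competes in its own member.\<close>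

lemma positive_mass_countably_additive: "countably_additive (sets borel) positive_mass"
  unfolding countably_additive_def
proof (intro allI impI antisym)
  fix F :: "nat \<Rightarrow> 'a set"
  assume F: "range F \<subseteq> sets borel" "disjoint_family F"
  have "(\<Sum>i<n. positive_mass (F i)) \<le> positive_mass (\<Union>i<n. F i)" for n
  proof (induction n)
    case (Suc n)
    have "(\<Sum>i<Suc n. positive_mass (F i)) \<le> positive_mass (\<Union>i<n. F i) + positive_mass (F n)"
      using Suc by (simp add: add_right_mono)
    also have "\<dots> \<le> positive_mass ((\<Union>i<n. F i) \<union> F n)"
    proof (rule positive_mass_superadd)
      have "F i \<inter> F n = {}" if "i < n" for i
        using disjoint_family_onD[OF F(2), of i n] that by auto
      then show "(\<Union>i<n. F i) \<inter> F n = {}" by auto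
    qed
    also have "(\<Union>i<n. F i) \<union> F n = (\<Union>i<Suc n. F i)"
      by (auto simp: less_Suc_eq)
    finally show ?case .
  qed (simp add: positive_mass_empty)
  also have "positive_mass (\<Union>i<n. F i) \<le> positive_mass (\<Union>i. F i)" for n
    by (intro positive_mass_mono) auto
  finally show "(\<Sum>i. positive_mass (F i)) \<le> positive_mass (\<Union>i. F i)"
    by (intro suminf_le_const summableI)
  show "positive_mass (\<Union>i. F i) \<le> (\<Sum>i. positive_mass (F i))"
  proof (rule positive_mass_least)
    fix B assume B: "B \<in> sets borel" "B \<subseteq> (\<Union>i. F i)"
    have "(\<lambda>i. \<rho> (B \<inter> F i)) sums \<rho> (\<Union>i. B \<inter> F i)"
    proof (rule sums)
      show "disjoint_family (\<lambda>i. B \<inter> F i)"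
        using F(2) by (rule disjoint_family_subset) auto
    qed (use B F in auto)
    moreover have "(\<Union>i. B \<inter> F i) = B" using B by auto
    ultimately have "(\<lambda>n. \<Sum>i<n. \<rho> (B \<inter> F i)) \<longlonglongrightarrow> \<rho> B"
      by (simp add: sums_def)
    then have "(\<lambda>n. ennreal (\<Sum>i<n. \<rho> (B \<inter> F i))) \<longlonglongrightarrow> ennreal (\<rho> B)"
      by (rule tendsto_ennrealI)
    moreover have "ennreal (\<Sum>i<n. \<rho> (B \<inter> F i)) \<le> (\<Sum>i. positive_mass (F i))" for n
    proof -
      \<comment> \<open>\<open>ennreal\<close> does not distribute over sums of mixed sign, so
        negative terms are first raised to 0.\<close>
      have "ennreal (\<Sum>i<n. \<rho> (B \<inter> F i)) \<le> ennreal (\<Sum>i<n. max 0 (\<rho> (B \<inter> F i)))"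
        by (intro ennreal_leI sum_mono) auto
      also have "\<dots> = (\<Sum>i<n. ennreal (max 0 (\<rho> (B \<inter> F i))))"
        by (rule sum_ennreal[symmetric]) auto
      also have "\<dots> \<le> (\<Sum>i<n. positive_mass (F i))"
        using B F by (intro sum_mono) (auto simp: ennreal_max_0 intro!: positive_mass_upper)
      also have "\<dots> \<le> (\<Sum>i. positive_mass (F i))"
        by (intro sum_le_suminf summableI) auto
      finally show ?thesis .
    qed
    ultimately show "ennreal (\<rho> B) \<le> (\<Sum>i. positive_mass (F i))"
      by (intro LIMSEQ_le_const2) auto
  qed
qed

section \<open>The Jordan parts as finite measures\<close>

lemma sets_positive_part: "sets (positive_part \<rho>) = sets borel"
  unfolding positive_part_def
  by (subst sets_measure_of) (auto simp: sets.sigma_sets_eq[of borel, simplified])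

lemma space_positive_part: "space (positive_part \<rho>) = UNIV"
  using sets_eq_imp_space_eq[OF sets_positive_part] by simp

lemma emeasure_positive_part:
  assumes "A \<in> sets borel"
  shows "emeasure (positive_part \<rho>) A = positive_mass A"
  unfolding positive_part_def positive_mass_def[symmetric]
proof (rule emeasure_measure_of_sigma)
  show "sigma_algebra UNIV (sets borel :: 'a set set)"
    using sets.sigma_algebra_axioms[of borel] by simp
  show "positive (sets borel) positive_mass"
    by (simp add: positive_def positive_mass_empty)
qed (use assms positive_mass_countably_additive in auto)

text \<open>A set of infinite positive mass loses a piece of \<open>\<rho>\<close>-mass larger than 1 in absolute value
  while keeping infinite positive mass; iterating this contradicts countable additivity.\<close>

lemma infinite_positive_mass_split:
  assumes E: "E \<in> sets borel" "positive_mass E = \<infinity>"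
  obtains E' where "E' \<in> sets borel" "E' \<subseteq> E" "positive_mass E' = \<infinity>" "1 < \<bar>\<rho> (E - E')\<bar>"
proof -
  \<comment> \<open>The margin \<open>\<bar>\<rho> E\<bar>\<close> ensures that \<open>B\<close> and
    \<open>E - B\<close> both have \<rho>-mass beyond 1 in absolute value, so either may be the
    discarded piece.\<close>
  have "ennreal (1 + \<bar>\<rho> E\<bar>) < positive_mass E" using E by simp
  then obtain B where B: "B \<in> sets borel" "B \<subseteq> E" "ennreal (1 + \<bar>\<rho> E\<bar>) < ennreal (\<rho> B)"
    unfolding positive_mass_def less_SUP_iff by auto
  then have big: "1 + \<bar>\<rho> E\<bar> < \<rho> B"
    by (simp add: ennreal_less_iff del: ennreal_plus ennreal_1)
  have "positive_mass E = positive_mass B + positive_mass (E - B)"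
  proof -
    have "emeasure (positive_part \<rho>) (B \<union> (E - B)) =
        emeasure (positive_part \<rho>) B + emeasure (positive_part \<rho>) (E - B)"
      using B E by (intro plus_emeasure[symmetric]) (auto simp: sets_positive_part)
    moreover have "B \<union> (E - B) = E" using B by auto
    ultimately show ?thesis using B E by (simp add: emeasure_positive_part)
  qed
  then have "positive_mass B = \<infinity> \<or> positive_mass (E - B) = \<infinity>"
    using E by (metis ennreal_add_eq_top infinity_ennreal_def)
  then show thesis
  proof
    assume "positive_mass B = \<infinity>"
    moreover have "1 < \<bar>\<rho> (E - B)\<bar>" using diff[OF B(1) E(1) B(2)] big by linarith
    ultimately show thesis using B that by blast
  next
    assume "positive_mass (E - B) = \<infinity>"
    moreover have "E - (E - B) = B" using B by auto
    ultimately show thesis using B E big by (intro that[of "E - B"]) auto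
  qed
qed

lemma positive_mass_finite: "positive_mass UNIV < \<infinity>"
proof (rule ccontr)
  assume "\<not> positive_mass UNIV < \<infinity>"
  then have top: "positive_mass UNIV = \<infinity>" by (simp add: less_top[symmetric])
  have "\<exists>E. \<forall>n. (E n \<in> sets borel \<and> positive_mass (E n) = \<infinity>)
      \<and> (E (Suc n) \<subseteq> E n \<and> 1 < \<bar>\<rho> (E n - E (Suc n))\<bar>)"
  proof (rule dependent_nat_choice)
    show "\<exists>E. E \<in> sets borel \<and> positive_mass E = \<infinity>" using top by (intro exI[of _ UNIV]) simp
    show "\<exists>E'. (E' \<in> sets borel \<and> positive_mass E' = \<infinity>) \<and> (E' \<subseteq> E \<and> 1 < \<bar>\<rho> (E - E')\<bar>)"
      if "E \<in> sets borel \<and> positive_mass E = \<infinity>" for E and n :: nat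
      using infinite_positive_mass_split[of E] that by metis
  qed
  then obtain E where E: "\<And>n. E n \<in> sets borel" "\<And>n. E (Suc n) \<subseteq> E n"
      "\<And>n. 1 < \<bar>\<rho> (E n - E (Suc n))\<bar>" by metis
  have dec: "E n \<subseteq> E m" if "m \<le> n" for m n
    using lift_Suc_antimono_le[of E, OF E(2) that] .
  \<comment> \<open>The discarded pieces are disjoint, so their \<rho>-masses form a convergent
    series, although no term is below 1 in absolute value.\<close>
  have "disjoint_family (\<lambda>n. E n - E (Suc n))"
    unfolding disjoint_family_on_def
  proof (intro ballI impI)
    fix m n :: nat assume "m \<noteq> n"
    then consider "Suc m \<le> n" | "Suc n \<le> m" by linarith
    then show "(E m - E (Suc m)) \<inter> (E n - E (Suc n)) = {}"
      using dec[of "Suc m" n] dec[of "Suc n" m] by cases auto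
  qed
  then have "(\<lambda>n. \<rho> (E n - E (Suc n))) sums \<rho> (\<Union>n. E n - E (Suc n))"
    using E by (intro sums) auto
  then have "(\<lambda>n. \<rho> (E n - E (Suc n))) \<longlonglongrightarrow> 0"
    by (intro summable_LIMSEQ_zero sums_summable)
  then obtain n where "\<forall>m\<ge>n. norm (\<rho> (E m - E (Suc m)) - 0) < 1"
    using LIMSEQ_D zero_less_one by blast
  then have "norm (\<rho> (E n - E (Suc n)) - 0) < 1" by blast
  then show False using E(3)[of n] by simp
qed

lemma finite_positive_part: "finite_measure (positive_part \<rho>)"
  using positive_mass_finite
  by (intro finite_measureI) (simp add: space_positive_part emeasure_positive_part)

text \<open>The complement of the support is a union of possibly uncountably many open null sets;
  Lindelof's theorem reduces it to countably many.\<close>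

lemma AE_positive_part_support: "AE x in positive_part \<rho>. x \<in> signed_support \<rho>"
proof -
  define \<U> where "\<U> = {U. open U \<and> (\<forall>B\<in>sets borel. B \<subseteq> U \<longrightarrow> \<rho> B = 0)}"
  obtain \<V> where V: "\<V> \<subseteq> \<U>" "countable \<V>" "\<Union>\<V> = \<Union>\<U>"
    using Lindelof[of \<U>] by (auto simp: \<U>_def)
  have "emeasure (positive_part \<rho>) U = 0" if "U \<in> \<V>" for U
  proof -
    have U: "open U" "\<And>B. B \<in> sets borel \<Longrightarrow> B \<subseteq> U \<Longrightarrow> \<rho> B = 0"
      using that V by (auto simp: \<U>_def)
    have "positive_mass U \<le> 0" using U by (intro positive_mass_least) simp
    then show ?thesis using U by (simp add: emeasure_positive_part)
  qed
  moreover have "U \<in> sets (positive_part \<rho>)" if "U \<in> \<V>" for U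
    using that V by (auto simp: \<U>_def sets_positive_part)
  ultimately have "(\<Union>U\<in>\<V>. U) \<in> null_sets (positive_part \<rho>)"
    using V(2) by (intro null_sets_UN') (auto simp: null_sets_def)
  moreover have "{x \<in> space (positive_part \<rho>). x \<notin> signed_support \<rho>} \<subseteq> (\<Union>U\<in>\<V>. U)"
    using V(3) by (auto simp: \<U>_def signed_support_def)
  ultimately show ?thesis by (intro AE_I') auto
qed

lemma signed_measure_uminus: "signed_measure (\<lambda>A. - \<rho> A)"
  using signed unfolding signed_measure_def signed_borel_measure_def by (auto intro: sums_minus)

lemma signed_support_uminus: "signed_support (\<lambda>A. - \<rho> A) = signed_support \<rho>"
  by (simp add: signed_support_def)

text \<open>As the total mass is 0, complementation changes the sign of \<rho> and so exchanges the
  competitors of the two suprema.\<close>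

lemma measure_parts_eq:
  assumes "\<rho> UNIV = 0"
  shows "measure (positive_part \<rho>) UNIV = measure (negative_part \<rho>) UNIV"
proof -
  interpret neg: signed_measure "\<lambda>A. - \<rho> A" by (rule signed_measure_uminus)
  have compl: "\<rho> (- B) = - \<rho> B" if "B \<in> sets borel" for B
    using diff[of B UNIV] that assms by (simp add: Compl_eq_Diff_UNIV)
  have "positive_mass UNIV = neg.positive_mass UNIV"
  proof (rule antisym)
    show "positive_mass UNIV \<le> neg.positive_mass UNIV"
      using neg.positive_mass_upper[of "- B" UNIV for B] compl
      by (intro positive_mass_least) (metis borel_comp minus_minus top_greatest)
    show "neg.positive_mass UNIV \<le> positive_mass UNIV"
      using positive_mass_upper[of "- B" UNIV for B] compl
      by (intro neg.positive_mass_least) (metis borel_comp top_greatest)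
  qed
  then show ?thesis
    by (simp add: measure_def negative_part_def emeasure_positive_part neg.emeasure_positive_part)
qed

section \<open>Push forward of the Jordan parts\<close>

lemma signed_measure_push_forward:
  assumes "S \<in> borel_measurable borel"
  shows "signed_measure (push_forward S \<rho>)"
proof -
  have "(\<lambda>k. \<rho> (S -` A k)) sums \<rho> (S -` (\<Union>k. A k))"
    if "range A \<subseteq> sets borel" "disjoint_family A" for A :: "nat \<Rightarrow> 'a set"
    unfolding vimage_UN
  proof (rule sums)
    show "S -` A k \<in> sets borel" for k
      using measurable_sets[OF assms, of "A k"] that by auto
    show "disjoint_family (\<lambda>k. S -` A k)"
      unfolding disjoint_family_on_def
    proof (intro ballI impI)
      fix m n :: nat assume "m \<noteq> n"
      then have "A m \<inter> A n = {}" by (intro disjoint_family_onD[OF that(2)]) auto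
      then show "S -` A m \<inter> S -` A n = {}" by auto
    qed
  qed
  then show ?thesis
    by (simp add: signed_measure_def signed_borel_measure_def push_forward_def empty)
qed

text \<open>A measurable inverse makes every Borel subset of the preimage of \<open>A\<close> the
  preimage of a Borel subset of \<open>A\<close>. Without injectivity, positive and negative mass
  could cancel under \<open>S\<close>.\<close>

lemma positive_part_push_forward:
  fixes S T :: "'a \<Rightarrow> 'a"
  assumes S: "S \<in> borel_measurable borel" and T: "T \<in> borel_measurable borel"
    and TS: "\<And>x. T (S x) = x" and ST: "\<And>x. S (T x) = x"
  shows "positive_part (push_forward S \<rho>) = distr (positive_part \<rho>) borel S"
proof -
  interpret push: signed_measure "push_forward S \<rho>" by (rule signed_measure_push_forward[OF S])
  have SM: "S \<in> measurable (positive_part \<rho>) borel"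
    using S by (simp add: measurable_def sets_positive_part space_positive_part)
  show ?thesis
  proof (rule measure_eqI)
    fix A assume "A \<in> sets (positive_part (push_forward S \<rho>))"
    then have A: "A \<in> sets borel" by (simp add: push.sets_positive_part)
    have vS: "S -` B \<in> sets borel" if "B \<in> sets borel" for B
      using measurable_sets[OF S that] by simp
    have vT: "T -` B \<in> sets borel" if "B \<in> sets borel" for B
      using measurable_sets[OF T that] by simp
    have "push.positive_mass A = positive_mass (S -` A)"
    proof (rule antisym)
      show "push.positive_mass A \<le> positive_mass (S -` A)"
        by (rule push.positive_mass_least) (auto simp: push_forward_def intro!: positive_mass_upper vS)
      show "positive_mass (S -` A) \<le> push.positive_mass A"
      proof (rule positive_mass_least)
        fix B assume B: "B \<in> sets borel" "B \<subseteq> S -` A"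
        have "S -` (T -` B) = B" by (auto simp: TS)
        moreover have "T -` B \<subseteq> A" using B(2) ST by (metis subset_vimage_iff vimageE subsetI subset_iff)
        ultimately show "ennreal (\<rho> B) \<le> push.positive_mass A"
          using push.positive_mass_upper[OF vT[OF B(1)], of A] by (simp add: push_forward_def)
      qed
    qed
    then show "emeasure (positive_part (push_forward S \<rho>)) A = emeasure (distr (positive_part \<rho>) borel S) A"
      using A vS[OF A] by (simp add: push.emeasure_positive_part emeasure_distr[OF SM A]
          space_positive_part emeasure_positive_part)
  qed (simp add: push.sets_positive_part)
qed

lemma signed_integral_push_forward:
  fixes S T :: "'a \<Rightarrow> 'a" and f :: "'a \<Rightarrow> 'b::{banach, second_countable_topology}"
  assumes S: "S \<in> borel_measurable borel" and T: "T \<in> borel_measurable borel"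
    and TS: "\<And>x. T (S x) = x" and ST: "\<And>x. S (T x) = x"
    and f: "f \<in> borel_measurable borel"
  shows "signed_integral (push_forward S \<rho>) f = signed_integral \<rho> (\<lambda>x. f (S x))"
proof -
  interpret neg: signed_measure "\<lambda>A. - \<rho> A" by (rule signed_measure_uminus)
  have neg: "(\<lambda>A. - push_forward S \<rho> A) = push_forward S (\<lambda>A. - \<rho> A)"
    by (simp add: push_forward_def)
  have "S \<in> measurable (positive_part \<rho>) borel" "S \<in> measurable (positive_part (\<lambda>A. - \<rho> A)) borel"
    using S by (simp_all add: measurable_def sets_positive_part space_positive_part
        neg.sets_positive_part neg.space_positive_part)
  then show ?thesis
    unfolding signed_integral_def negative_part_def neg
    by (simp add: positive_part_push_forward[OF S T TS ST] neg.positive_part_push_forward[OF S T TS ST]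
        integral_distr f)
qed

end

section \<open>Compactness\<close>

locale balanced_measure = signed_measure +
  assumes compact_support: "compact (signed_support \<rho>)"
    and balanced: "\<rho> UNIV = 0"
begin

definition mass :: real where "mass = measure (positive_part \<rho>) UNIV"

lemma mass_nonneg: "0 \<le> mass"
  by (simp add: mass_def)

lemma parts:
  assumes "M = positive_part \<rho> \<or> M = negative_part \<rho>"
  shows "finite_measure M" "sets M = sets borel" "space M = UNIV" "measure M UNIV = mass"
    "AE x in M. x \<in> signed_support \<rho>"
proof -
  interpret neg: signed_measure "\<lambda>A. - \<rho> A" by (rule signed_measure_uminus)
  show "finite_measure M" "sets M = sets borel" "space M = UNIV"
    using assms finite_positive_part neg.finite_positive_part sets_positive_part
      neg.sets_positive_part space_positive_part neg.space_positive_part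
    by (auto simp: negative_part_def)
  show "measure M UNIV = mass"
    using assms measure_parts_eq[OF balanced] by (auto simp: mass_def)
  show "AE x in M. x \<in> signed_support \<rho>"
    using assms AE_positive_part_support neg.AE_positive_part_support
    by (auto simp: negative_part_def signed_support_uminus)
qed

lemma integrable_parts:
  fixes f :: "'a \<Rightarrow> 'b::euclidean_space"
  assumes M: "M = positive_part \<rho> \<or> M = negative_part \<rho>" and f: "continuous_on UNIV f"
  shows "integrable M f"
proof -
  interpret finite_measure M by (rule parts[OF M])
  have "compact (f ` signed_support \<rho>)"
    using compact_support f by (intro compact_continuous_image) (auto intro: continuous_on_subset)
  then obtain B where "\<And>x. x \<in> signed_support \<rho> \<Longrightarrow> norm (f x) \<le> B"
    by (meson compact_imp_bounded bounded_iff imageI)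
  then have "AE x in M. norm (f x) \<le> B"
    using parts(5)[OF M] by auto
  moreover have "f \<in> borel_measurable M"
    using borel_measurable_continuous_onI[OF f] parts[OF M] by (simp add: measurable_def)
  ultimately show ?thesis by (rule integrable_const_bound)
qed

lemma signed_integral_diff:
  fixes f g :: "'a \<Rightarrow> 'b::euclidean_space"
  assumes "continuous_on UNIV f" "continuous_on UNIV g"
  shows "signed_integral \<rho> (\<lambda>x. f x - g x) = signed_integral \<rho> f - signed_integral \<rho> g"
  using integrable_parts[OF _ assms(1)] integrable_parts[OF _ assms(2)]
  by (simp add: signed_integral_def)

lemma signed_integral_const: "signed_integral \<rho> (\<lambda>x. c) = (0::'b::euclidean_space)"
  using parts by (simp add: signed_integral_def)

text \<open>The two Jordan parts have equal mass, so \<open>c\<close> may be subtracted for free: it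
  is the oscillation of \<open>f\<close> on the support that counts.\<close>

lemma abs_signed_integral_le:
  fixes f :: "'a \<Rightarrow> real"
  assumes f: "continuous_on UNIV f" and B: "\<And>x. x \<in> signed_support \<rho> \<Longrightarrow> \<bar>f x - c\<bar> \<le> B"
  shows "\<bar>signed_integral \<rho> f\<bar> \<le> 2 * mass * B"
proof -
  have fc: "continuous_on UNIV (\<lambda>x. f x - c)" by (intro continuous_intros f)
  have le: "\<bar>LINT x|M. f x - c\<bar> \<le> mass * B" if M: "M = positive_part \<rho> \<or> M = negative_part \<rho>" for M
  proof -
    interpret finite_measure M by (rule parts[OF M])
    have "\<bar>LINT x|M. f x - c\<bar> \<le> (LINT x|M. \<bar>f x - c\<bar>)" by (rule integral_abs_bound)
    also have "\<dots> \<le> (LINT x|M. B)"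
    proof (rule integral_mono_AE)
      show "AE x in M. \<bar>f x - c\<bar> \<le> B" using parts(5)[OF M] B by auto
    qed (use integrable_parts[OF M fc] in auto)
    also have "\<dots> = mass * B" using parts[OF M] by simp
    finally show ?thesis .
  qed
  have "signed_integral \<rho> f = signed_integral \<rho> (\<lambda>x. f x - c)"
    using signed_integral_diff[OF f, of "\<lambda>x. c"] signed_integral_const[of c] by simp
  then show ?thesis
    using le[of "positive_part \<rho>"] le[of "negative_part \<rho>"] by (simp add: signed_integral_def)
qed

text \<open>The translation contributes \<open>mass *\<^sub>R z\<close> to both Jordan parts and
  cancels. For orthogonal \<open>T\<close> the norm of the moment is therefore scaled by
  \<open>r\<close> alone.\<close>

lemma signed_integral_affine:
  fixes T :: "'a \<Rightarrow> 'a"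
  assumes "linear T"
  shows "signed_integral \<rho> (\<lambda>x. r *\<^sub>R T x + z) = r *\<^sub>R T (signed_integral \<rho> (\<lambda>x. x))"
proof -
  have T: "bounded_linear T" using assms by (simp add: linear_conv_bounded_linear)
  have int: "integrable M (\<lambda>x. x)" "integrable M T" if "M = positive_part \<rho> \<or> M = negative_part \<rho>" for M
    using that T by (auto intro!: integrable_parts linear_continuous_on)
  have "(\<integral>x. r *\<^sub>R T x + z \<partial>M) = r *\<^sub>R T (\<integral>x. x \<partial>M) + mass *\<^sub>R z"
    if M: "M = positive_part \<rho> \<or> M = negative_part \<rho>" for M
  proof -
    interpret finite_measure M by (rule parts[OF M])
    show ?thesis
      using int[OF M] parts[OF M] integral_bounded_linear[OF T int(1)[OF M]] by simp
  qed
  then show ?thesis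
    using assms by (simp add: signed_integral_def linear_diff algebra_simps)
qed

end

text \<open>O(n) in the operator norm: closed because evaluation is continuous, bounded by 1, and
  contained in a finite-dimensional space.\<close>

lemma compact_orthogonal_blinfun:
  "compact {T :: 'a::euclidean_space \<Rightarrow>\<^sub>L 'a. \<forall>x. norm (blinfun_apply T x) = norm x}"
proof -
  have "closed {T :: 'a \<Rightarrow>\<^sub>L 'a. \<forall>x. norm (blinfun_apply T x) = norm x}"
    by (intro closed_Collect_all closed_Collect_eq continuous_intros)
  moreover have "bounded {T :: 'a \<Rightarrow>\<^sub>L 'a. \<forall>x. norm (blinfun_apply T x) = norm x}"
    by (rule boundedI[where B = 1]) (auto intro: norm_blinfun_bound)
  ultimately show ?thesis by (simp add: compact_eq_bounded_closed)
qed

text \<open>Supplies the measurable two-sided inverse required for pushing forward the Jordan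
  parts.\<close>

lemma similarity_inverse:
  fixes T :: "'a::euclidean_space \<Rightarrow> 'a"
  assumes "0 < r" "orthogonal_transformation T"
  obtains S' where "S' \<in> borel_measurable borel" "\<And>x. S' (r *\<^sub>R T x + z) = x" "\<And>x. r *\<^sub>R T (S' x) + z = x"
proof
  let ?S' = "\<lambda>y. inv T ((1 / r) *\<^sub>R (y - z))"
  have bij: "bij T" by (rule orthogonal_transformation_bij[OF assms(2)])
  have "linear (inv T)"
    by (intro orthogonal_transformation_linear orthogonal_transformation_inv assms)
  then have "continuous_on UNIV (inv T)"
    by (simp add: linear_continuous_on linear_conv_bounded_linear)
  then show "?S' \<in> borel_measurable borel"
    by (intro borel_measurable_continuous_onI) (rule continuous_on_compose2[of UNIV "inv T"], auto intro!: continuous_intros)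
  show "?S' (r *\<^sub>R T x + z) = x" for x
    using assms bij by (simp add: bij_is_inj)
  show "r *\<^sub>R T (?S' x) + z = x" for x
    using assms bij by (simp add: bij_is_surj surj_f_inv_f)
qed

section \<open>Maximising the quotient over the similarities\<close>

locale holder_sobolev_measure = holder_sobolev u g p + balanced_measure \<rho>
  for u :: "'a::euclidean_space \<Rightarrow> real" and g p and \<rho> :: "'a set \<Rightarrow> real" +
  assumes moment_nonzero: "signed_integral \<rho> (\<lambda>x. x) \<noteq> 0"
begin

definition moment :: real where "moment = norm (signed_integral \<rho> (\<lambda>x. x))"

text \<open>The difference quotient in the coordinates of a similarity, with the integrals pulled
  back to \<rho>. Bounded linear maps as a type provide the topology for continuity and
  compactness.\<close>

definition quotient :: "real \<times> ('a \<Rightarrow>\<^sub>L 'a) \<times> 'a \<Rightarrow> real" where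
  "quotient = (\<lambda>(r, T, z). \<bar>signed_integral \<rho> (\<lambda>y. u (r *\<^sub>R blinfun_apply T y + z))\<bar> / (r * moment) powr \<alpha>)"

definition orthogonal_maps :: "('a \<Rightarrow>\<^sub>L 'a) set" where
  "orthogonal_maps = {T. \<forall>x. norm (blinfun_apply T x) = norm x}"

lemma moment_pos: "0 < moment"
  using moment_nonzero by (simp add: moment_def)

lemma continuous_rescaled: "continuous_on UNIV (\<lambda>y. u (r *\<^sub>R blinfun_apply T y + z))"
  by (intro continuous_on_compose2[OF continuous_u] continuous_intros) auto

lemma difference_quotient_eq:
  assumes "0 < r" and T: "orthogonal_transformation T"
  shows "difference_quotient p u (push_forward (\<lambda>y. r *\<^sub>R T y + z) \<rho>) = quotient (r, Blinfun T, z)"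
proof -
  obtain S' where S': "S' \<in> borel_measurable borel"
      "\<And>x. S' (r *\<^sub>R T x + z) = x" "\<And>x. r *\<^sub>R T (S' x) + z = x"
    using similarity_inverse[OF assms, of z] by metis
  have lin: "linear T" by (rule orthogonal_transformation_linear[OF T])
  then have bl: "bounded_linear T" by (simp add: linear_conv_bounded_linear)
  have S: "(\<lambda>y. r *\<^sub>R T y + z) \<in> borel_measurable borel"
    using linear_continuous_on[OF bl]
    by (intro borel_measurable_continuous_onI continuous_intros) auto
  note push = signed_integral_push_forward[OF S S'(1), OF S'(2) S'(3)]
  have "norm (signed_integral (push_forward (\<lambda>y. r *\<^sub>R T y + z) \<rho>) (\<lambda>x. x)) = r * moment"
    using push[of "\<lambda>x. x"] signed_integral_affine[OF lin] assms
    by (simp add: moment_def orthogonal_transformation_norm)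
  then show ?thesis
    using push[OF borel_measurable_continuous_onI[OF continuous_u]]
    by (simp add: difference_quotient_def quotient_def \<alpha>_def[symmetric] bounded_linear_Blinfun_apply[OF bl])
qed

text \<open>The similarity maps the support into the ball of radius \<open>r * R\<close> about
  \<open>z\<close>, and the powers of \<open>r\<close> cancel against those of the moment.\<close>

lemma quotient_le:
  assumes r: "0 < r" and T: "T \<in> orthogonal_maps" and R: "0 < R" "\<And>y. y \<in> signed_support \<rho> \<Longrightarrow> norm y \<le> R"
    and osc: "\<And>y. dist z y \<le> r * R \<Longrightarrow> \<bar>u z - u y\<bar> \<le> \<epsilon> * (r * R) powr \<alpha>"
  shows "quotient (r, T, z) \<le> 2 * mass * \<epsilon> * (R / moment) powr \<alpha>"
proof -
  have "\<bar>signed_integral \<rho> (\<lambda>y. u (r *\<^sub>R blinfun_apply T y + z))\<bar> \<le> 2 * mass * (\<epsilon> * (r * R) powr \<alpha>)"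
  proof (rule abs_signed_integral_le[OF continuous_rescaled, where c = "u z"])
    fix y assume "y \<in> signed_support \<rho>"
    then have "dist z (r *\<^sub>R blinfun_apply T y + z) \<le> r * R"
      using r R T by (simp add: dist_norm orthogonal_maps_def)
    then show "\<bar>u (r *\<^sub>R blinfun_apply T y + z) - u z\<bar> \<le> \<epsilon> * (r * R) powr \<alpha>"
      using osc abs_minus_commute by metis
  qed
  then have "quotient (r, T, z) \<le> 2 * mass * (\<epsilon> * (r * R) powr \<alpha>) / (r * moment) powr \<alpha>"
    unfolding quotient_def by (simp add: divide_right_mono)
  also have "\<dots> = 2 * mass * \<epsilon> * (r * R / (r * moment)) powr \<alpha>"
    using r R moment_pos by (subst powr_divide) (auto simp: mult.assoc)
  also have "r * R / (r * moment) = R / moment" using r by simp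
  finally show ?thesis .
qed

text \<open>Hoelder continuity turns a small displacement of the support, uniform over its points,
  into a small change of the integral; positivity of \<open>r\<close> matters for the
  denominator.\<close>

lemma continuous_quotient: "continuous_on ({0<..} \<times> UNIV) quotient"
proof -
  obtain C where C: "0 < C" "\<And>x y. \<bar>u x - u y\<bar> \<le> C * dist x y powr \<alpha>"
    using holder_const by metis
  obtain R where R: "\<And>y. y \<in> signed_support \<rho> \<Longrightarrow> norm y \<le> R"
    using compact_imp_bounded[OF compact_support] by (auto simp: bounded_iff)
  define I where "I s = signed_integral \<rho> (\<lambda>y. u (fst s *\<^sub>R blinfun_apply (fst (snd s)) y + snd (snd s)))"
    for s :: "real \<times> ('a \<Rightarrow>\<^sub>L 'a) \<times> 'a"
  \<comment> \<open>Bounds the displacement of support points between the parameters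
    \<open>s\<close> and \<open>s'\<close>. No sign is recorded for \<open>R\<close>, so the
    absolute value of \<open>h\<close> serves as base of \<open>powr\<close>.\<close>
  define h where "h s s' = norm (fst s' *\<^sub>R fst (snd s') - fst s *\<^sub>R fst (snd s)) * R
      + norm (snd (snd s') - snd (snd s))" for s s' :: "real \<times> ('a \<Rightarrow>\<^sub>L 'a) \<times> 'a"
  have diff: "\<bar>I s' - I s\<bar> \<le> 2 * mass * (C * \<bar>h s s'\<bar> powr \<alpha>)" for s s'
  proof -
    let ?f = "\<lambda>s y. u (fst s *\<^sub>R blinfun_apply (fst (snd s)) y + snd (snd s))"
    have "\<bar>signed_integral \<rho> (\<lambda>y. ?f s' y - ?f s y)\<bar> \<le> 2 * mass * (C * \<bar>h s s'\<bar> powr \<alpha>)"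
    proof (rule abs_signed_integral_le[where c = 0])
      show "continuous_on UNIV (\<lambda>y. ?f s' y - ?f s y)"
        by (intro continuous_on_diff continuous_rescaled)
      fix y assume y: "y \<in> signed_support \<rho>"
      let ?D = "fst s' *\<^sub>R fst (snd s') - fst s *\<^sub>R fst (snd s)"
      have "dist (fst s' *\<^sub>R blinfun_apply (fst (snd s')) y + snd (snd s'))
            (fst s *\<^sub>R blinfun_apply (fst (snd s)) y + snd (snd s))
          = norm (blinfun_apply ?D y + (snd (snd s') - snd (snd s)))"
        by (simp add: dist_norm blinfun.diff_left blinfun.scaleR_left algebra_simps)
      also have "\<dots> \<le> norm ?D * norm y + norm (snd (snd s') - snd (snd s))"
        by (intro order_trans[OF norm_triangle_ineq] add_right_mono norm_blinfun)
      also have "\<dots> \<le> h s s'"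
        unfolding h_def using R[OF y] by (intro add_right_mono mult_left_mono) auto
      also have "\<dots> \<le> \<bar>h s s'\<bar>" by simp
      finally show "\<bar>?f s' y - ?f s y - 0\<bar> \<le> C * \<bar>h s s'\<bar> powr \<alpha>"
        using C(1) \<alpha>_pos
        by (simp only: diff_0_right) (intro order_trans[OF C(2)] mult_left_mono powr_mono2, auto)
    qed
    then show ?thesis
      unfolding I_def by (simp add: signed_integral_diff[OF continuous_rescaled continuous_rescaled])
  qed
  have "(I \<longlongrightarrow> I s) (at s)" for s
  proof (rule LIM_zero_cancel, rule Lim_null_comparison)
    show "\<forall>\<^sub>F s' in at s. norm (I s' - I s) \<le> 2 * mass * (C * \<bar>h s s'\<bar> powr \<alpha>)"
      using diff by simp
    have "((\<lambda>s'. h s s') \<longlongrightarrow> norm (fst s *\<^sub>R fst (snd s) - fst s *\<^sub>R fst (snd s)) * R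
      + norm (snd (snd s) - snd (snd s))) (at s)"
      unfolding h_def by (intro tendsto_intros)
    then have "((\<lambda>s'. h s s') \<longlongrightarrow> 0) (at s)" by simp
    then have "((\<lambda>s'. 2 * mass * (C * \<bar>h s s'\<bar> powr \<alpha>)) \<longlongrightarrow> 2 * mass * (C * \<bar>0\<bar> powr \<alpha>)) (at s)"
      using \<alpha>_pos by (intro tendsto_mult tendsto_const tendsto_powr' tendsto_rabs) auto
    then show "((\<lambda>s'. 2 * mass * (C * \<bar>h s s'\<bar> powr \<alpha>)) \<longlongrightarrow> 0) (at s)" by simp
  qed
  then have "continuous_on ({0<..} \<times> UNIV) I"
    unfolding continuous_on_def by (blast intro: tendsto_within_subset)
  then have "continuous_on ({0<..} \<times> UNIV) (\<lambda>s. \<bar>I s\<bar> / (fst s * moment) powr \<alpha>)"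
    using moment_pos by (intro continuous_intros) auto
  then show ?thesis
    by (simp add: quotient_def I_def split_beta)
qed

lemma quotient_attains_max:
  obtains r T z where "0 < r" "T \<in> orthogonal_maps"
    "\<And>r' T' z'. 0 < r' \<Longrightarrow> T' \<in> orthogonal_maps \<Longrightarrow> quotient (r', T', z') \<le> quotient (r, T, z)"
proof (cases "\<exists>r T z. 0 < r \<and> T \<in> orthogonal_maps \<and> 0 < quotient (r, T, z)")
  case False
  have "id_blinfun \<in> orthogonal_maps" by (simp add: orthogonal_maps_def)
  moreover have "0 \<le> quotient (1, id_blinfun, 0)" by (simp add: quotient_def)
  moreover have "quotient (r', T', z') \<le> 0" if "0 < r'" "T' \<in> orthogonal_maps" for r' :: real and T' z'
    using False that by (meson not_less)
  ultimately show thesis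
    by (intro that[of 1 id_blinfun 0]) (auto intro: order_trans)
next
  case True
  then obtain r0 T0 z0 where s0: "0 < r0" "T0 \<in> orthogonal_maps" "0 < quotient (r0, T0, z0)" by blast
  let ?q0 = "quotient (r0, T0, z0)"
  obtain R' where R': "\<And>y. y \<in> signed_support \<rho> \<Longrightarrow> norm y \<le> R'"
    using compact_imp_bounded[OF compact_support] by (auto simp: bounded_iff)
  define R where "R = max 1 R'"
  have R: "0 < R" "\<And>y. y \<in> signed_support \<rho> \<Longrightarrow> norm y \<le> R"
    using R' by (auto simp: R_def le_max_iff_disj)
  \<comment> \<open>The summand 1 keeps \<open>w\<close> positive without a proof that
    \<open>mass\<close> is.\<close>
  define w where "w = (2 * mass + 1) * (R / moment) powr \<alpha>"
  have w: "0 < w" using mass_nonneg R moment_pos by (simp add: w_def add_nonneg_pos)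
  \<comment> \<open>An oscillation bound with this \<epsilon> forces the quotient down to at most
    half of \<open>?q0\<close>.\<close>
  define \<epsilon> where "\<epsilon> = ?q0 / (2 * w)"
  have \<epsilon>: "0 < \<epsilon>" using s0 w by (simp add: \<epsilon>_def)
  have small: "quotient (r, T, z) < ?q0"
    if "0 < r" "T \<in> orthogonal_maps" "\<And>y. dist z y \<le> r * R \<Longrightarrow> \<bar>u z - u y\<bar> \<le> \<epsilon> * (r * R) powr \<alpha>" for r T z
  proof -
    have "quotient (r, T, z) \<le> 2 * mass * \<epsilon> * (R / moment) powr \<alpha>"
      using that R by (intro quotient_le) auto
    also have "\<dots> \<le> \<epsilon> * w"
      using \<epsilon> by (simp add: w_def algebra_simps)
    also have "\<epsilon> * w < ?q0" using s0 w by (simp add: \<epsilon>_def)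
    finally show ?thesis .
  qed
  obtain a where a: "0 < a"
    "\<And>x y r. 0 < r \<Longrightarrow> r < a \<Longrightarrow> dist x y \<le> r \<Longrightarrow> \<bar>u x - u y\<bar> \<le> \<epsilon> * r powr \<alpha>"
    using decay_small_scale[OF \<epsilon>] by metis
  obtain b where b: "0 < b"
    "\<And>x y r. b \<le> r \<Longrightarrow> dist x y \<le> r \<Longrightarrow> \<bar>u x - u y\<bar> \<le> \<epsilon> * r powr \<alpha>"
    using decay_large_scale[OF \<epsilon>] by metis
  obtain Z where Z:
    "\<And>x y r. 0 < r \<Longrightarrow> r \<le> b \<Longrightarrow> dist x y \<le> r \<Longrightarrow> Z \<le> norm x \<Longrightarrow> \<bar>u x - u y\<bar> \<le> \<epsilon> * r powr \<alpha>"
    using decay_far[OF \<epsilon> b(1)] by metis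
  \<comment> \<open>The decay estimates concern the ball radius \<open>r * R\<close>, hence the
    division by \<open>R\<close>. Each way of leaving \<open>K\<close> falls under one of the three
    regimes.\<close>
  define K where "K = {a / R..b / R} \<times> orthogonal_maps \<times> cball (0::'a) Z"
  have outside: "quotient (r, T, z) < ?q0" if "0 < r" "T \<in> orthogonal_maps" "(r, T, z) \<notin> K" for r T z
  proof -
    have rR: "0 < r * R" using that R by simp
    have "r * R < a \<or> b \<le> r * R \<or> (r * R \<le> b \<and> Z \<le> norm z)"
      using that R by (auto simp: K_def field_simps)
    then show ?thesis
      using that a(2) b(2) Z rR by (intro small) blast+
  qed
  have "compact K"
    unfolding K_def orthogonal_maps_def
    by (intro compact_Times compact_orthogonal_blinfun compact_Icc compact_cball)
  \<comment> \<open>Thus the maximum over \<open>K\<close> is at least \<open>?q0\<close>, which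
    exceeds every value outside \<open>K\<close>, and so it is global.\<close>
  moreover have in_K: "(r0, T0, z0) \<in> K"
    using outside s0 by blast
  moreover have "K \<subseteq> {0<..} \<times> UNIV"
  proof -
    have "0 < a / R" using a R by simp
    then show ?thesis by (auto simp: K_def)
  qed
  moreover from this have "continuous_on K quotient"
    using continuous_quotient continuous_on_subset by blast
  ultimately obtain s where s: "s \<in> K" "\<And>s'. s' \<in> K \<Longrightarrow> quotient s' \<le> quotient s"
    using continuous_attains_sup[of K quotient] by blast
  obtain r T z where rTz: "s = (r, T, z)" by (cases s) auto
  show thesis
  proof
    show "0 < r" using s rTz \<open>K \<subseteq> {0<..} \<times> UNIV\<close> by auto
    show "T \<in> orthogonal_maps" using s rTz by (simp add: K_def)
    fix r' :: real and T' z' assume "0 < r'" "T' \<in> orthogonal_maps"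
    then show "quotient (r', T', z') \<le> quotient (r, T, z)"
      using outside[of r' T' z'] s in_K rTz by (cases "(r', T', z') \<in> K") force+
  qed
qed

lemma seminorm_attained:
  obtains S where "S \<in> similarities"
    "rho_seminorm p \<rho> u = ereal (difference_quotient p u (push_forward S \<rho>))"
proof -
  obtain r T z where max: "0 < r" "T \<in> orthogonal_maps"
    "\<And>r' T' z'. 0 < r' \<Longrightarrow> T' \<in> orthogonal_maps \<Longrightarrow> quotient (r', T', z') \<le> quotient (r, T, z)"
    using quotient_attains_max by metis
  define S where "S = (\<lambda>y. r *\<^sub>R blinfun_apply T y + z)"
  have T: "orthogonal_transformation (blinfun_apply T)"
    using max by (simp add: orthogonal_transformation orthogonal_maps_def blinfun.bounded_linear_right
        bounded_linear.linear)
  have S: "S \<in> similarities"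
    unfolding similarities_def S_def using max T by blast
  have dq: "difference_quotient p u (push_forward S \<rho>) = quotient (r, T, z)"
    unfolding S_def using difference_quotient_eq[OF max(1) T] by (simp add: blinfun_apply_inverse)
  have le: "difference_quotient p u (push_forward S' \<rho>) \<le> difference_quotient p u (push_forward S \<rho>)"
    if "S' \<in> similarities" for S'
  proof -
    obtain r' T' z' where S': "0 < r'" "orthogonal_transformation T'" "S' = (\<lambda>y. r' *\<^sub>R T' y + z')"
      using \<open>S' \<in> similarities\<close> unfolding similarities_def by blast
    have "bounded_linear T'"
      using S'(2) by (simp add: orthogonal_transformation_linear flip: linear_conv_bounded_linear)
    then have "Blinfun T' \<in> orthogonal_maps"
      using S'(2) by (simp add: orthogonal_maps_def bounded_linear_Blinfun_apply orthogonal_transformation_norm)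
    then show ?thesis
      using max(3) S' by (simp add: dq difference_quotient_eq)
  qed
  have "rho_seminorm p \<rho> u = ereal (difference_quotient p u (push_forward S \<rho>))"
    unfolding rho_seminorm_def
  proof (rule antisym)
    show "(SUP \<mu>\<in>{push_forward S \<rho> |S. S \<in> similarities}. ereal (difference_quotient p u \<mu>))
        \<le> ereal (difference_quotient p u (push_forward S \<rho>))"
      using le by (intro SUP_least) auto
    show "ereal (difference_quotient p u (push_forward S \<rho>))
        \<le> (SUP \<mu>\<in>{push_forward S \<rho> |S. S \<in> similarities}. ereal (difference_quotient p u \<mu>))"
      using S by (intro SUP_upper) auto
  qed
  with S show thesis by (rule that)
qed

end

theorem proposition2p2:
  fixes p :: real
    and \<rho> :: "'a::euclidean_space set \<Rightarrow> real"
    and u :: "'a \<Rightarrow> real"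
  assumes "real DIM('a) < p"
    and "admissible_measure \<rho>"
    and "u \<in> D1p p"
    and "holder_continuous (1 - real DIM('a) / p) u"
  shows "\<exists>S\<in>similarities.
           rho_seminorm p \<rho> u =
           ereal (\<bar>signed_integral (push_forward S \<rho>) u\<bar> /
                  norm (signed_integral (push_forward S \<rho>) (\<lambda>x. x))
                    powr (1 - real DIM('a) / p))"
proof -
  obtain g where g: "\<And>i. i \<in> Basis \<Longrightarrow> g i \<in> Lp_functions p"
      "\<And>i. i \<in> Basis \<Longrightarrow> weak_partial_derivative u i (g i)"
    using assms(3) unfolding D1p_def by (simp, metis)
  interpret holder_sobolev_measure u g p \<rho>
    using assms g by unfold_locales (auto simp: admissible_measure_def)
  obtain S where "S \<in> similarities"
      "rho_seminorm p \<rho> u = ereal (difference_quotient p u (push_forward S \<rho>))"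
    by (rule seminorm_attained)
  then show ?thesis
    unfolding difference_quotient_def by blast
qed

end
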